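(* Let $(X,T)$ be a fixed-point free dynamical system. Then the connectivity of $P_p(X)$ grows at most linearly in $p$: there exists a positive number $C$ such that $\mathrm{conn}\, P_p(X) < C\cdot p$ for all prime numbers $p$.
   Context: A dynamical system is a pair $(X,T)$ where $X$ is a compact metrizable space and $T:X\to X$ is a homeomorphism. For $n\geq 1$, $P_n(X)=P_n(X,T):=\{x\in X\mid T^n x=x\}$ with the subspace topology. The system is fixed-point free if $P_1(X,T)=\emptyset$. For a non-empty topological space $Y$, its connectivity $\mathrm{conn}(Y)$ is the smallest integer $n\geq -1$ such that $\pi_{n+1}(Y)\neq 0$ (where $\pi_0(Y)\ne 0$ means that $Y$ is not path-connected), and it is $\infty$ if there is no such $n$. By convention $\mathrm{conn}(\emptyset)=-2$. *)

theory Defs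
  imports "HOL-Analysis.Analysis" "HOL-Computational_Algebra.Primes"
begin

definition dynamical_system :: "'a topology \<Rightarrow> ('a \<Rightarrow> 'a) \<Rightarrow> bool" where
  "dynamical_system X T \<longleftrightarrow>
     compact_space X \<and> metrizable_space X \<and> homeomorphic_map X X T"

definition periodic_points :: "'a topology \<Rightarrow> ('a \<Rightarrow> 'a) \<Rightarrow> nat \<Rightarrow> 'a topology" where
  "periodic_points X T n = subtopology X {x \<in> topspace X. (T ^^ n) x = x}"

definition fixed_point_free :: "'a topology \<Rightarrow> ('a \<Rightarrow> 'a) \<Rightarrow> bool" where
  "fixed_point_free X T \<longleftrightarrow> topspace (periodic_points X T 1) = {}"

definition nsphere_base :: "nat \<Rightarrow> real" where
  "nsphere_base = (\<lambda>i. if i = 0 then 1 else 0)"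

definition based_sphere_maps :: "nat \<Rightarrow> 'a topology \<Rightarrow> 'a \<Rightarrow> ((nat \<Rightarrow> real) \<Rightarrow> 'a) set" where
  "based_sphere_maps k Y y =
     {f. continuous_map (nsphere k) Y f \<and> f nsphere_base = y}"

text \<open>
  The underlying set of $\pi_k(Y,y)$: based maps from the $k$-sphere modulo homotopies that
  keep the base point at \<open>y\<close>.  Values of a map outside the sphere are irrelevant: two maps
  that agree on the sphere are always homotopic in this sense.  The group operation is omitted;
  a group is zero iff its underlying set is a singleton.
\<close>
definition homotopy_set :: "nat \<Rightarrow> 'a topology \<Rightarrow> 'a \<Rightarrow> ((nat \<Rightarrow> real) \<Rightarrow> 'a) set set" where
  "homotopy_set k Y y =
     based_sphere_maps k Y y //
       {(f, g). f \<in> based_sphere_maps k Y y \<and> g \<in> based_sphere_maps k Y y \<and>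
                homotopic_with (\<lambda>h. h nsphere_base = y) (nsphere k) Y f g}"

text \<open>
  \<open>pi_nonzero k Y\<close> says $\pi_k(Y) \neq 0$, where for $k = 0$ this means that \<open>Y\<close> is not
  path-connected.  For $k > 0$ it is read as nontriviality at some base point; in the definition
  of connectivity below it matters only for path-connected \<open>Y\<close>, where the base point plays no role.
\<close>
definition pi_nonzero :: "nat \<Rightarrow> 'a topology \<Rightarrow> bool" where
  "pi_nonzero k Y \<longleftrightarrow>
     (if k = 0 then \<not> path_connected_space Y
      else (\<exists>y \<in> topspace Y. \<not> is_singleton (homotopy_set k Y y)))"

definition conn :: "'a topology \<Rightarrow> ereal" where
  "conn Y =
     (if topspace Y = {} then - 2
      else if \<exists>n::int. n \<ge> - 1 \<and> pi_nonzero (nat (n + 1)) Y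
      then ereal (of_int (LEAST n. n \<ge> - 1 \<and> pi_nonzero (nat (n + 1)) Y))
      else \<infinity>)"

end

theory Submission
  imports Defs "HOL-Homology.Homology" "HOL-Number_Theory.Cong"
begin

text \<open>
  By compactness finitely many continuous real functions \<open>\<phi> i\<close>, \<open>i < N\<close>, separate each \<open>x\<close> from
  \<open>T x\<close>.  Hence for \<open>x \<in> P_p(X)\<close> some cyclic sequence \<open>\<phi> i (T^a x)\<close> is not constant, and the set \<open>S\<close>
  of the indices of its \<open>r\<close> smallest entries is well defined for some \<open>0 < r < p\<close>.  Since \<open>r\<close> is
  invertible modulo \<open>p\<close>, the sum of the elements of \<open>S\<close> yields an equivariant locally constant map to
  \<open>\<int>/p\<close>.  So \<open>P_p(X)\<close> is covered by at most \<open>N p\<close> invariant open sets, each with an equivariant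
  map to \<open>\<int>/p\<close>.

  If the homotopy groups of \<open>P_p(X)\<close> vanished below degree \<open>2 N p\<close>, every singular cycle in these
  degrees would bound, so that singular chains \<open>w 0, \<dots>, w (2 N p)\<close> could be chosen as images of the
  generators of the periodic resolution of \<open>\<int>/p\<close>.  The powers of the degree two class of \<open>\<int>/p\<close>
  evaluate to 1 modulo \<open>p\<close> on them.  But over each set of the cover this class is represented by
  a cocycle vanishing on small simplices, and the product of \<open>N p\<close> such representatives vanishes on a fine
  subdivision of \<open>w (2 N p)\<close>.
\<close>

subsection \<open>Cochains that depend on the vertices\<close>

definition simplex_vertices :: "nat \<Rightarrow> ((nat \<Rightarrow> real) \<Rightarrow> 'a) \<Rightarrow> 'a list"
  where "simplex_vertices p f = map (\<lambda>i. f (\<lambda>j. if j = i then 1 else 0)) [0..<Suc p]"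

text \<open>The simplicial coboundary, with the face opposite the first vertex split off. In this
  form it unfolds together with the recursive cup products below.\<close>

fun coboundary :: "('a list \<Rightarrow> int) \<Rightarrow> 'a list \<Rightarrow> int" where
  "coboundary \<phi> [] = 0"
| "coboundary \<phi> (x # xs) = \<phi> xs - coboundary (\<lambda>ys. \<phi> (x # ys)) xs"

text \<open>The integers are encoded as the free abelian group on \<open>()\<close>, so that
  \<open>frag_extend\<close> provides the linear extension from simplices to chains.\<close>

definition cochain_eval :: "nat \<Rightarrow> ('a list \<Rightarrow> int) \<Rightarrow> 'a chain \<Rightarrow> int"
  where "cochain_eval p \<phi> c =
    Poly_Mapping.lookup
      (frag_extend (\<lambda>f. frag_cmul (\<phi> (simplex_vertices p f)) (frag_of ())) c) ()"

lemma length_simplex_vertices [simp]: "length (simplex_vertices p f) = Suc p"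
  by (simp add: simplex_vertices_def)

lemma coboundary_mult_left: "coboundary (\<lambda>ys. a * \<phi> ys) xs = a * coboundary \<phi> xs"
  by (induction xs arbitrary: \<phi>) (simp_all add: right_diff_distrib)

lemma coboundary_eq_sum:
  "coboundary \<phi> xs = (\<Sum>k<length xs. (-1) ^ k * \<phi> (take k xs @ drop (Suc k) xs))"
proof (induction xs arbitrary: \<phi>)
  case (Cons x xs)
  show ?case
    by (simp only: coboundary.simps Cons length_Cons sum.lessThan_Suc_shift)
       (simp add: sum_negf)
qed simp

lemma cochain_eval_0 [simp]: "cochain_eval p \<phi> 0 = 0"
  by (simp add: cochain_eval_def)

lemma cochain_eval_of [simp]: "cochain_eval p \<phi> (frag_of f) = \<phi> (simplex_vertices p f)"
  by (simp add: cochain_eval_def)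

lemma cochain_eval_diff:
  "cochain_eval p \<phi> (a - b) = cochain_eval p \<phi> a - cochain_eval p \<phi> b"
  by (simp add: cochain_eval_def frag_extend_diff lookup_minus)

lemma cochain_eval_add:
  "cochain_eval p \<phi> (a + b) = cochain_eval p \<phi> a + cochain_eval p \<phi> b"
  by (simp add: cochain_eval_def frag_extend_add lookup_add)

lemma cochain_eval_cmul: "cochain_eval p \<phi> (frag_cmul k a) = k * cochain_eval p \<phi> a"
  by (simp add: cochain_eval_def frag_extend_cmul)

lemma cochain_eval_sum:
  "cochain_eval p \<phi> (\<Sum>i\<in>I. c i) = (\<Sum>i\<in>I. cochain_eval p \<phi> (c i))"
  by (induction I rule: infinite_finite_induct) (simp_all add: cochain_eval_add)

lemma simplex_vertices_singular_face:
  assumes "1 \<le> p" "k \<le> p"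
  shows "simplex_vertices (p - Suc 0) (singular_face p k f) =
         take k (simplex_vertices p f) @ drop (Suc k) (simplex_vertices p f)"
proof (rule nth_equalityI)
  show "length (simplex_vertices (p - Suc 0) (singular_face p k f)) =
        length (take k (simplex_vertices p f) @ drop (Suc k) (simplex_vertices p f))"
    using assms by simp
next
  fix i assume "i < length (simplex_vertices (p - Suc 0) (singular_face p k f))"
  then have i: "i < p" "i \<le> p - Suc 0"
    using assms by simp_all
  \<comment> \<open>The face inclusion sends vertices to vertices and skips vertex
    \<open>k\<close>.\<close>
  have *: "simplical_face k (\<lambda>j. if j = i then 1 else (0::real)) =
           (\<lambda>j. if j = (if i < k then i else Suc i) then 1 else 0)"
    by (auto simp: simplical_face_def fun_eq_iff)
  have nth: "simplex_vertices q h ! n = h (\<lambda>j. if j = n then 1 else 0)"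
    if "n \<le> q" for q n and h :: "(nat \<Rightarrow> real) \<Rightarrow> 'a"
    using that by (simp add: simplex_vertices_def del: upt_Suc)
  have "simplex_vertices (p - Suc 0) (singular_face p k f) ! i =
        f (\<lambda>j. if j = (if i < k then i else Suc i) then 1 else 0)"
    using i by (simp add: nth singular_face_def * del: if_split)
  then show "simplex_vertices (p - Suc 0) (singular_face p k f) ! i =
        (take k (simplex_vertices p f) @ drop (Suc k) (simplex_vertices p f)) ! i"
    using i assms by (cases p) (auto simp: nth_append nth)
qed

text \<open>Since face \<open>k\<close> of a simplex has the vertex list with entry \<open>k\<close>
  deleted, Stokes' formula holds on each simplex and extends linearly.\<close>

lemma cochain_eval_boundary:
  "cochain_eval p \<phi> (chain_boundary (Suc p) c) = cochain_eval (Suc p) (coboundary \<phi>) c"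
proof -
  \<comment> \<open>The trivial bound on the keys puts the claim into the form required by
    \<open>frag_induction\<close>.\<close>
  have "c \<in> {c. Poly_Mapping.keys c \<subseteq> UNIV}" by simp
  then show ?thesis
    unfolding mem_Collect_eq
  proof (induction c rule: frag_induction)
    case (one f)
    have "cochain_eval p \<phi> (chain_boundary (Suc p) (frag_of f)) =
        (\<Sum>k\<le>Suc p. (-1) ^ k * \<phi> (simplex_vertices p (singular_face (Suc p) k f)))"
      by (simp add: chain_boundary_of cochain_eval_sum cochain_eval_cmul
          del: sum.atMost_Suc)
    also have "\<dots> = coboundary \<phi> (simplex_vertices (Suc p) f)"
      using simplex_vertices_singular_face[of "Suc p" _ f]
      by (simp add: coboundary_eq_sum lessThan_Suc_atMost del: sum.atMost_Suc sum.lessThan_Suc)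
    finally show ?case
      by (simp only: cochain_eval_of)
  next
    case (diff a b)
    then show ?case
      by (simp add: chain_boundary_diff cochain_eval_diff)
  qed simp
qed

lemma set_simplex_vertices:
  "f \<in> standard_simplex p \<rightarrow> V \<Longrightarrow> set (simplex_vertices p f) \<subseteq> V"
  by (auto simp: simplex_vertices_def Pi_iff simp del: upt_Suc)

lemma singular_simplex_vertices:
  "singular_simplex p X f \<Longrightarrow> set (simplex_vertices p f) \<subseteq> topspace X"
  by (rule set_simplex_vertices) (simp add: singular_simplex_def continuous_map_def)

lemma cochain_eval_cong_mod:
  assumes "singular_chain p X c"
    and "\<And>vs. \<lbrakk>length vs = Suc p; set vs \<subseteq> topspace X\<rbrakk> \<Longrightarrow> [\<phi> vs = \<psi> vs] (mod n)"
  shows "[cochain_eval p \<phi> c = cochain_eval p \<psi> c] (mod n)"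
  using assms(1) unfolding singular_chain_def
proof (induction c rule: frag_induction)
  case (one f)
  then show ?case
    using assms(2) singular_simplex_vertices[of p X f] by simp
qed (auto simp: cochain_eval_diff cong_diff)

lemma cochain_eval_cong:
  assumes "singular_chain p X c"
    and "\<And>vs. \<lbrakk>length vs = Suc p; set vs \<subseteq> topspace X\<rbrakk> \<Longrightarrow> \<phi> vs = \<psi> vs"
  shows "cochain_eval p \<phi> c = cochain_eval p \<psi> c"
  \<comment> \<open>Congruence modulo 0 is equality.\<close>
  using cochain_eval_cong_mod[of p X c \<phi> \<psi> 0] assms by simp

lemma cochain_eval_eq_0:
  assumes "\<And>f. f \<in> Poly_Mapping.keys c \<Longrightarrow> \<phi> (simplex_vertices p f) = 0"
  shows "cochain_eval p \<phi> c = 0"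
  using assms by (simp add: cochain_eval_def frag_extend_def)

lemma cochain_eval_chain_map:
  "cochain_eval p \<phi> (chain_map p T c) = cochain_eval p (\<lambda>vs. \<phi> (map T vs)) c"
proof -
  have "c \<in> {c. Poly_Mapping.keys c \<subseteq> UNIV}" by simp
  then show ?thesis
    unfolding mem_Collect_eq
  proof (induction c rule: frag_induction)
    case (one f)
    have "simplex_vertices p (simplex_map p T f) = map T (simplex_vertices p f)"
      by (simp add: simplex_vertices_def simplex_map_def del: upt_Suc)
    then show ?case by simp
  qed (simp_all add: chain_map_diff cochain_eval_diff)
qed

lemma cochain_eval_diff_left:
  "cochain_eval p (\<lambda>vs. \<phi> vs - \<psi> vs) c = cochain_eval p \<phi> c - cochain_eval p \<psi> c"
proof -
  have "c \<in> {c. Poly_Mapping.keys c \<subseteq> UNIV}" by simp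
  then show ?thesis
    unfolding mem_Collect_eq
    by (induction c rule: frag_induction) (simp_all add: cochain_eval_diff)
qed

lemma cochain_eval_mult_left:
  "cochain_eval p (\<lambda>vs. a * \<phi> vs) c = a * cochain_eval p \<phi> c"
proof -
  have "c \<in> {c. Poly_Mapping.keys c \<subseteq> UNIV}" by simp
  then show ?thesis
    unfolding mem_Collect_eq
    by (induction c rule: frag_induction) (simp_all add: cochain_eval_diff right_diff_distrib)
qed

subsection \<open>Cup products and the periodic resolution\<close>

text \<open>Cup products with a cochain of degree 0, 1 or 2 in front, by the Alexander-Whitney
  formula: front and back face share one vertex.\<close>

fun cup0 :: "('a \<Rightarrow> int) \<Rightarrow> ('a list \<Rightarrow> int) \<Rightarrow> 'a list \<Rightarrow> int" where
  "cup0 g c (x # xs) = g x * c (x # xs)"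
| "cup0 g c [] = 0"

fun cup1 :: "('a \<Rightarrow> 'a \<Rightarrow> int) \<Rightarrow> ('a list \<Rightarrow> int) \<Rightarrow> 'a list \<Rightarrow> int" where
  "cup1 q c (x # y # ys) = q x y * c (y # ys)"
| "cup1 q c _ = 0"

text \<open>The iterated product of \<open>\<psi> (k - 1)\<close>, ..., \<open>\<psi> 0\<close> in
  this order. Each factor uses up two vertices and leaves the shared vertex \<open>z\<close> to the
  next.\<close>

fun cup2_product :: "(nat \<Rightarrow> 'a \<Rightarrow> 'a \<Rightarrow> 'a \<Rightarrow> int) \<Rightarrow> nat \<Rightarrow> 'a list \<Rightarrow> int" where
  "cup2_product \<psi> 0 xs = 1"
| "cup2_product \<psi> (Suc k) (x # y # z # zs) = \<psi> k x y z * cup2_product \<psi> k (z # zs)"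
| "cup2_product \<psi> (Suc k) _ = 0"

text \<open>The Leibniz rule; the cocycle condition on \<open>c\<close> removes the term containing
  its coboundary.\<close>

lemma coboundary_cup0:
  assumes "coboundary c (x # y # ys) = 0"
  shows "coboundary (cup0 g c) (x # y # ys) = (g y - g x) * c (y # ys)"
proof -
  have "c (y # ys) = coboundary (\<lambda>zs. c (x # zs)) (y # ys)"
    using assms by simp
  then show ?thesis
    by (simp add: coboundary_mult_left left_diff_distrib del: coboundary.simps(2))
       (simp add: coboundary_mult_left left_diff_distrib coboundary.simps(2)[of _ x])
qed

lemma coboundary_cup1:
  assumes "coboundary c (y # z # zs) = 0"
  shows "coboundary (cup1 q c) (x # y # z # zs) = (q y z - q x z + q x y) * c (z # zs)"
proof -
  \<comment> \<open>The face that deletes \<open>z\<close> is the one whose second factor needs the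
    cocycle condition.\<close>
  have "c (y # zs) = c (z # zs) + coboundary (\<lambda>ys. c (y # z # ys)) zs"
    using assms by simp
  then show ?thesis
    by (simp add: coboundary_mult_left algebra_simps)
qed

text \<open>Induction with the Leibniz rule: the front factor is a cocycle by hypothesis, the
  remaining product by the induction hypothesis.\<close>

lemma coboundary_cup2_product:
  assumes "\<And>k x y z w. \<psi> k y z w - \<psi> k x z w + \<psi> k x y w - \<psi> k x y z = 0"
    and "length vs = 2 * k + 2"
  shows "coboundary (cup2_product \<psi> k) vs = 0"
  using assms(2)
proof (induction k arbitrary: vs)
  case 0
  then obtain x y where "vs = [x, y]"
    by (metis One_nat_def Suc_1 add_0 length_0_conv length_Suc_conv mult_0_right)
  then show ?case by simp
next
  case (Suc k)
  then have "length vs = Suc (Suc (Suc (Suc (2 * k))))"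
    by simp
  then obtain x y z w ws where vs: "vs = x # y # z # w # ws"
    by (auto simp: length_Suc_conv)
  have "coboundary (cup2_product \<psi> k) (z # w # ws) = 0"
    by (rule Suc.IH) (use Suc.prems vs in simp)
  then have *: "cup2_product \<psi> k (z # ws) =
      cup2_product \<psi> k (w # ws) + coboundary (\<lambda>zs. cup2_product \<psi> k (z # w # zs)) ws"
    by simp
  have "coboundary (cup2_product \<psi> (Suc k)) vs =
      (\<psi> k y z w - \<psi> k x z w + \<psi> k x y w - \<psi> k x y z) * cup2_product \<psi> k (w # ws)"
    by (simp add: vs coboundary_mult_left * algebra_simps)
  then show ?case
    using assms(1) by simp
qed

lemma cup2_product_map:
  assumes "\<And>k x y z. \<lbrakk>x \<in> S; y \<in> S; z \<in> S\<rbrakk> \<Longrightarrow> \<psi> k (T x) (T y) (T z) = \<psi> k x y z"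
    and "set vs \<subseteq> S"
  shows "cup2_product \<psi> k (map T vs) = cup2_product \<psi> k vs"
  using assms(2) by (induction \<psi>' \<equiv> \<psi> k vs rule: cup2_product.induct) (auto simp: assms(1))

lemma cup2_product_eq_0:
  assumes "\<And>x y z. \<lbrakk>x \<in> S; y \<in> S; z \<in> S\<rbrakk> \<Longrightarrow> \<psi> j x y z = 0"
    and "set vs \<subseteq> S" and "j < k" 
  shows "cup2_product \<psi> k vs = 0"
  using assms(2,3) 
  by (induction \<psi>' \<equiv> \<psi> k vs rule: cup2_product.induct) (auto simp: assms(1) less_Suc_eq)

text \<open>
  The image of a generator of the periodic resolution of \<open>\<int>/p\<close> in degree \<open>k\<close> has boundary
  \<open>T - 1\<close> or the norm \<open>1 + T + \<dots> + T ^ (p - 1)\<close> applied to the one in degree \<open>k - 1\<close>.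
\<close>
definition equivariant_boundary :: "nat \<Rightarrow> ('a \<Rightarrow> 'a) \<Rightarrow> nat \<Rightarrow> 'a chain \<Rightarrow> 'a chain"
  where "equivariant_boundary p T k c =
    (if even k then chain_map k T c - c else (\<Sum>a<p. chain_map k (T ^^ a) c))"

definition resolution_chains ::
    "nat \<Rightarrow> ('a \<Rightarrow> 'a) \<Rightarrow> 'a topology \<Rightarrow> nat \<Rightarrow> (nat \<Rightarrow> 'a chain) \<Rightarrow> bool"
  where "resolution_chains p T Y n w \<longleftrightarrow>
    (\<forall>k\<le>n. singular_chain k Y (w k)) \<and> cochain_eval 0 (\<lambda>_. 1) (w 0) = 1 \<and>
    (\<forall>k<n. chain_boundary (Suc k) (w (Suc k)) = equivariant_boundary p T k (w k))"

text \<open>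
  A class in degree \<open>2k + 2\<close> is evaluated through its primitive: with \<open>p \<psi> = \<delta>q\<close> the invariance
  of \<open>q\<close> turns the norm in \<open>\<partial>w (2k + 2)\<close> into a factor \<open>p\<close>, which cancels; then
  \<open>q \<equiv> \<delta>g\<close> modulo \<open>p\<close>, and \<open>g \<circ> T \<equiv> g + 1\<close> takes the pairing from degree \<open>2k + 1\<close> to \<open>2k\<close>.
\<close>
lemma cup2_product_pairing:
  fixes p :: nat and w :: "nat \<Rightarrow> 'a chain" and T :: "'a \<Rightarrow> 'a"
    and g :: "'a \<Rightarrow> int" and q :: "nat \<Rightarrow> 'a \<Rightarrow> 'a \<Rightarrow> int"
  assumes "p > 0"
    and T: "\<And>x. x \<in> topspace Y \<Longrightarrow> T x \<in> topspace Y"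
    and res: "resolution_chains p T Y (2 * m) w"
    and g: "\<And>x. x \<in> topspace Y \<Longrightarrow> [g (T x) = g x + 1] (mod int p)"
    and q_inv: "\<And>k x y. \<lbrakk>x \<in> topspace Y; y \<in> topspace Y\<rbrakk> \<Longrightarrow> q k (T x) (T y) = q k x y"
    and q_g: "\<And>k x y. [q k x y = g y - g x] (mod int p)"
    and \<psi>: "\<And>k x y z. int p * \<psi> k x y z = q k y z - q k x z + q k x y"
    and "k \<le> m"
  shows "[cochain_eval (2 * k) (cup2_product \<psi> k) (w (2 * k)) = 1] (mod int p)"
  using \<open>k \<le> m\<close>
proof (induction k)
  case 0
  have w0: "cochain_eval 0 (\<lambda>_. 1) (w 0) = 1"
    using res by (simp add: resolution_chains_def)
  have "cup2_product \<psi> 0 = (\<lambda>_. 1)" by (rule ext) simp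
  then show ?case using w0 by simp
next
  case (Suc k)
  let ?c = "cup2_product \<psi> k"
  define d where "d = 2 * k"
  have k: "k < m" "d \<le> 2 * m" "Suc d \<le> 2 * m" "Suc (Suc d) \<le> 2 * m"
    using Suc.prems by (auto simp: d_def)
  have w: "singular_chain i Y (w i)" if "i \<le> 2 * m" for i
    using res that by (simp add: resolution_chains_def)
  have w_odd: "chain_boundary (Suc d) (w (Suc d)) = chain_map d T (w d) - w d"
    and w_even: "chain_boundary (Suc (Suc d)) (w (Suc (Suc d))) =
                    (\<Sum>a<p. chain_map (Suc d) (T ^^ a) (w (Suc d)))"
    using res k by (simp_all add: resolution_chains_def equivariant_boundary_def d_def)
  \<comment> \<open>Multiplied by \<open>p\<close> the expression is the double coboundary of
    \<open>q k\<close>, which is 0, and \<open>p\<close> cancels in the integers.\<close>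
  have \<psi>_cocycle: "\<psi> k y z w - \<psi> k x z w + \<psi> k x y w - \<psi> k x y z = 0" for k x y z w
  proof -
    have "int p * (\<psi> k y z w - \<psi> k x z w + \<psi> k x y w - \<psi> k x y z) = 0"
      by (simp add: right_diff_distrib distrib_left \<psi>)
    then show ?thesis using \<open>p > 0\<close> by simp
  qed
  have \<psi>_inv: "\<psi> k (T x) (T y) (T z) = \<psi> k x y z"
    if "x \<in> topspace Y" "y \<in> topspace Y" "z \<in> topspace Y" for k x y z
  proof -
    have "int p * \<psi> k (T x) (T y) (T z) = int p * \<psi> k x y z"
      using that by (simp add: \<psi> q_inv)
    then show ?thesis using \<open>p > 0\<close> by simp
  qed
  have c_inv: "?c (map T vs) = ?c vs" if "set vs \<subseteq> topspace Y" for vs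
    using cup2_product_map[of "topspace Y" \<psi> T vs k] \<psi>_inv that by blast
  have cocycle: "coboundary ?c vs = 0" if "length vs = Suc (Suc d)" for vs
    using coboundary_cup2_product[of \<psi> vs k] \<psi>_cocycle that by (simp add: d_def)
  have qc_inv: "cup1 (q k) ?c (map T vs) = cup1 (q k) ?c vs" if "set vs \<subseteq> topspace Y" for vs
  \<comment> \<open>The rule serves as a split into lists of length 0, 1 and at least 2, matching
    the clauses of \<open>cup1\<close>.\<close>
  proof (cases vs rule: remdups_adj.cases)
    case (3 x y ys)
    then show ?thesis
      using that c_inv[of "y # ys"] by (simp add: q_inv)
  qed simp_all
  have qc_inv_pow: "cup1 (q k) ?c (map (T ^^ a) vs) = cup1 (q k) ?c vs"
    if "set vs \<subseteq> topspace Y" for vs a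
    using that
  proof (induction a arbitrary: vs)
    case (Suc a)
    have "map (T ^^ Suc a) vs = map (T ^^ a) (map T vs)"
      by (simp add: funpow_swap1)
    moreover have "set (map T vs) \<subseteq> topspace Y"
      using Suc.prems T by auto
    ultimately show ?case
      using Suc.IH[of "map T vs"] qc_inv[OF Suc.prems] by (simp only:)
  qed simp
  have coboundary_qc: "int p * cup2_product \<psi> (Suc k) vs = coboundary (cup1 (q k) ?c) vs"
    if "length vs = Suc (Suc (Suc d))" for vs
  proof -
    obtain x y z zs where vs: "vs = x # y # z # zs"
      using \<open>length vs = _\<close> by (metis Suc_length_conv)
    have "coboundary ?c (y # z # zs) = 0"
      using that by (intro cocycle) (simp add: vs)
    from coboundary_cup1[OF this, of "q k" x] show ?thesis
      by (simp only: vs cup2_product.simps \<psi> flip: mult.assoc)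
  qed
  have "int p * cochain_eval (Suc (Suc d)) (cup2_product \<psi> (Suc k)) (w (Suc (Suc d))) =
        cochain_eval (Suc (Suc d)) (\<lambda>vs. int p * cup2_product \<psi> (Suc k) vs) (w (Suc (Suc d)))"
    by (simp only: cochain_eval_mult_left)
  also have "\<dots> = cochain_eval (Suc (Suc d)) (coboundary (cup1 (q k) ?c)) (w (Suc (Suc d)))"
    by (rule cochain_eval_cong[OF w[OF k(4)]]) (rule coboundary_qc)
  also have "\<dots> = (\<Sum>a<p. cochain_eval (Suc d) (cup1 (q k) ?c)
                      (chain_map (Suc d) (T ^^ a) (w (Suc d))))"
    using w_even by (simp only: cochain_eval_sum flip: cochain_eval_boundary)
  also have "\<dots> = (\<Sum>a<p. cochain_eval (Suc d) (cup1 (q k) ?c) (w (Suc d)))"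
    unfolding cochain_eval_chain_map
    by (intro sum.cong refl cochain_eval_cong[OF w[OF k(3)]] qc_inv_pow)
  finally have "cochain_eval (Suc (Suc d)) (cup2_product \<psi> (Suc k)) (w (Suc (Suc d))) =
      cochain_eval (Suc d) (cup1 (q k) ?c) (w (Suc d))"
    using \<open>p > 0\<close> by simp
  also have "[\<dots> = cochain_eval (Suc d) (coboundary (cup0 g ?c)) (w (Suc d))] (mod int p)"
  proof (rule cochain_eval_cong_mod[OF w[OF k(3)]])
    fix vs :: "'a list" assume len: "length vs = Suc (Suc d)"
    then obtain x y ys where vs: "vs = x # y # ys"
      by (metis Suc_length_conv)
    show "[cup1 (q k) ?c vs = coboundary (cup0 g ?c) vs] (mod int p)"
      using coboundary_cup0[of ?c x y ys g] cocycle[OF len] q_g[of k x y]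
      by (simp only: vs cup1.simps cong_scalar_right)
  qed
  also have "cochain_eval (Suc d) (coboundary (cup0 g ?c)) (w (Suc d)) =
      cochain_eval d (\<lambda>vs. cup0 g ?c (map T vs) - cup0 g ?c vs) (w d)"
    using w_odd
    by (simp only: cochain_eval_diff cochain_eval_diff_left cochain_eval_chain_map
        flip: cochain_eval_boundary)
  also have "[\<dots> = cochain_eval d ?c (w d)] (mod int p)"
  proof (rule cochain_eval_cong_mod[OF w[OF k(2)]])
    fix vs :: "'a list" assume vs: "length vs = Suc d" "set vs \<subseteq> topspace Y"
    then obtain x ys where xs: "vs = x # ys"
      by (metis Suc_length_conv)
    then have "[g (T x) - g x = 1] (mod int p)"
      using g[of x] vs by (simp add: cong_iff_dvd_diff algebra_simps)
    then have "[(g (T x) - g x) * ?c vs = 1 * ?c vs] (mod int p)"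
      by (rule cong_scalar_right)
    moreover have "cup0 g ?c (map T vs) - cup0 g ?c vs = (g (T x) - g x) * ?c vs"
      using c_inv[OF vs(2)] by (simp add: xs left_diff_distrib)
    ultimately show "[cup0 g ?c (map T vs) - cup0 g ?c vs = ?c vs] (mod int p)"
      by simp
  qed
  also have "[cochain_eval d ?c (w d) = 1] (mod int p)"
    using Suc by (simp add: d_def)
  finally show ?case by (simp add: d_def)
qed

section \<open>Subdivision and a bound on the length of a resolution\<close>

lemma singular_subdivision_sum:
  "singular_subdivision k (\<Sum>i\<in>I. c i) = (\<Sum>i\<in>I. singular_subdivision k (c i))"
  by (induction I rule: infinite_finite_induct) (simp_all add: singular_subdivision_add)

text \<open>Subdivision is a natural chain map, so it commutes with the boundary and with
  \<open>T\<close>; in degree 0 it is the identity and keeps the augmentation.\<close>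

lemma resolution_chains_subdivision:
  assumes "resolution_chains p T Y n w"
  shows "resolution_chains p T Y n (\<lambda>k. singular_subdivision k (w k))"
proof -
  have w: "singular_chain k Y (w k)" if "k \<le> n" for k
    using assms that by (simp add: resolution_chains_def)
  have "chain_boundary (Suc k) (singular_subdivision (Suc k) (w (Suc k))) =
      equivariant_boundary p T k (singular_subdivision k (w k))" if "k < n" for k
  proof -
    have naturality: "singular_subdivision k (chain_map k f (w k)) =
        chain_map k f (singular_subdivision k (w k))" for f :: "'a \<Rightarrow> 'a"
      using that by (intro naturality_singular_subdivision[OF w]) simp
    have "chain_boundary (Suc k) (singular_subdivision (Suc k) (w (Suc k))) =
        singular_subdivision k (equivariant_boundary p T k (w k))"
      using chain_boundary_singular_subdivision[OF w[of "Suc k"]] assms that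
      by (simp add: resolution_chains_def)
    also have "\<dots> = equivariant_boundary p T k (singular_subdivision k (w k))"
      using naturality that
      by (simp add: equivariant_boundary_def singular_subdivision_diff singular_subdivision_sum)
    finally show ?thesis .
  qed
  moreover have "singular_subdivision 0 (w 0) = w 0"
    using singular_subdivision_zero[OF w[of 0]] by simp
  ultimately show ?thesis
    using assms by (simp add: resolution_chains_def singular_chain_singular_subdivision)
qed

lemma resolution_chains_subdivision_power:
  assumes "resolution_chains p T Y n w"
  shows "resolution_chains p T Y n (\<lambda>k. (singular_subdivision k ^^ M) (w k))"
proof (induction M)
  case (Suc M)
  then show ?case
    using resolution_chains_subdivision by fastforce
qed (use assms in simp)

text \<open>Each simplex of a fine subdivision of \<open>w (2 * m)\<close> lies in an open set where
  some \<open>l j\<close> is constant. Factor \<open>j\<close> of the product of degree two cocycles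
  vanishes there, so the product pairs to 0, whereas the pairing is 1 modulo
  \<open>p\<close>.\<close>

lemma resolution_chains_length:
  fixes l :: "nat \<Rightarrow> 'a \<Rightarrow> int"
  assumes "p \<ge> 2"
    and T: "\<And>x. x \<in> topspace Y \<Longrightarrow> T x \<in> topspace Y"
    and l: "\<And>j x. x \<in> topspace Y \<Longrightarrow> [l j (T x) = l j x + 1] (mod int p)"
    and cover: "\<And>x. x \<in> topspace Y \<Longrightarrow>
        \<exists>U j. openin Y U \<and> x \<in> U \<and> j < m \<and> (\<forall>y\<in>U. l j y = l j x)"
  shows "\<not> resolution_chains p T Y (2 * m) w"
proof
  assume w: "resolution_chains p T Y (2 * m) w"
  define \<C> where "\<C> = {U. openin Y U \<and> (\<exists>j<m. \<exists>c. \<forall>y\<in>U. l j y = c)}"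
  obtain M where M: "\<And>f. f \<in> Poly_Mapping.keys ((singular_subdivision (2 * m) ^^ M) (w (2 * m)))
      \<Longrightarrow> \<exists>V \<in> \<C>. f \<in> standard_simplex (2 * m) \<rightarrow> V"
  proof (rule sufficient_iterated_singular_subdivision_exists)
    show "openin Y U" if "U \<in> \<C>" for U
      using that by (simp add: \<C>_def)
    show "topspace Y \<subseteq> \<Union>\<C>"
    proof
      fix x assume "x \<in> topspace Y"
      then obtain U j where "openin Y U" "x \<in> U" "j < m" "\<forall>y\<in>U. l j y = l j x"
        using cover by metis
      then have "U \<in> \<C>" by (auto simp: \<C>_def)
      with \<open>x \<in> U\<close> show "x \<in> \<Union>\<C>" by blast
    qed
    show "singular_chain (2 * m) Y (w (2 * m))"
      using w by (simp add: resolution_chains_def)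
  qed blast
  define w' where "w' k = (singular_subdivision k ^^ M) (w k)" for k
  have w': "resolution_chains p T Y (2 * m) w'"
    unfolding w'_def by (rule resolution_chains_subdivision_power[OF w])
  define h where "h j x = (l 0 x - l j x) mod int p" for j x
  \<comment> \<open>Reducing the differences of \<open>l j\<close> modulo \<open>p\<close> makes
    \<open>q j\<close> strictly invariant. Adding the differences of the invariant
    \<open>h j\<close> makes it congruent to the differences of \<open>l 0\<close>, so that one
    function \<open>g\<close> serves all factors.\<close>
  define q where "q j x y = h j y - h j x + (l j y - l j x) mod int p" for j x y
  \<comment> \<open>The terms in \<open>h j\<close> cancel here. What remains is the carry cocycle,
    which represents the degree two class of the cyclic group, pulled back along
    \<open>l j\<close>.\<close>
  define \<psi> where "\<psi> j x y z = (q j y z - q j x z + q j x y) div int p" for j x y z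
  have h_inv: "h j (T x) = h j x" if "x \<in> topspace Y" for j x
  proof -
    have "[l 0 (T x) - l j (T x) = (l 0 x + 1) - (l j x + 1)] (mod int p)"
      using that by (intro cong_diff l)
    then show ?thesis
      by (simp add: h_def cong_def)
  qed
  have q_inv: "q j (T x) (T y) = q j x y" if "x \<in> topspace Y" "y \<in> topspace Y" for j x y
  proof -
    have "[l j (T y) - l j (T x) = (l j y + 1) - (l j x + 1)] (mod int p)"
      using that by (intro cong_diff l)
    then show ?thesis
      using that by (simp add: q_def h_inv cong_def)
  qed
  have q_g: "[q j x y = l 0 y - l 0 x] (mod int p)" for j x y
  proof -
    have "[q j x y = (l 0 y - l j y) - (l 0 x - l j x) + (l j y - l j x)] (mod int p)"
      unfolding q_def h_def by (intro cong_add cong_diff) (simp_all add: cong_def)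
    then show ?thesis by simp
  qed
  have \<psi>: "int p * \<psi> j x y z = q j y z - q j x z + q j x y" for j x y z
  proof -
    have "[q j y z - q j x z + q j x y =
        (l 0 z - l 0 y) - (l 0 z - l 0 x) + (l 0 y - l 0 x)] (mod int p)"
      by (intro cong_add cong_diff q_g)
    then have "int p dvd q j y z - q j x z + q j x y"
      by (simp add: cong_0_iff)
    then show ?thesis
      by (simp add: \<psi>_def)
  qed
  have "p > 0" using \<open>p \<ge> 2\<close> by simp
  have "[cochain_eval (2 * m) (cup2_product \<psi> m) (w' (2 * m)) = 1] (mod int p)"
    by (rule cup2_product_pairing[where g = "l 0" and q = q and Y = Y and T = T and m = m])
       (fact \<open>p > 0\<close> T w' l q_inv q_g \<psi> order_refl)+
  moreover have "cochain_eval (2 * m) (cup2_product \<psi> m) (w' (2 * m)) = 0"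
  proof (rule cochain_eval_eq_0)
    fix f assume "f \<in> Poly_Mapping.keys (w' (2 * m))"
    then obtain V where "V \<in> \<C>" and V: "f \<in> standard_simplex (2 * m) \<rightarrow> V"
      using M[of f] by (auto simp: w'_def)
    then obtain j c where j: "j < m" "\<And>y. y \<in> V \<Longrightarrow> l j y = c"
      unfolding \<C>_def by auto
    show "cup2_product \<psi> m (simplex_vertices (2 * m) f) = 0"
    proof (rule cup2_product_eq_0[OF _ set_simplex_vertices[OF V] j(1)])
      \<comment> \<open>No carry arises where \<open>l j\<close> is constant.\<close>
      show "\<psi> j x y z = 0" if "x \<in> V" "y \<in> V" "z \<in> V" for x y z
        using that by (simp add: \<psi>_def q_def j(2))
    qed
  qed
  ultimately show False
    using \<open>p \<ge> 2\<close> by (simp add: cong_def)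
qed

subsection \<open>Extending maps from the boundary of a simplex\<close>

lemma singular_simplex_0_eqI:
  assumes "singular_simplex 0 Y f" "singular_simplex 0 Y g"
    and "f (\<lambda>j. if j = 0 then 1 else 0) = g (\<lambda>j. if j = 0 then 1 else 0)"
  shows "f = g"
proof (rule extensionalityI)
  show "f \<in> extensional (standard_simplex 0)" "g \<in> extensional (standard_simplex 0)"
    using assms by (auto simp: singular_simplex_def)
qed (use assms(3) in \<open>auto simp: standard_simplex_0\<close>)

lemma singular_simplex_path:
  assumes "path_connected_space Y" and a: "singular_simplex 0 Y a" and b: "singular_simplex 0 Y b"
  shows "\<exists>f. singular_simplex 1 Y f \<and> singular_face 1 0 f = a \<and> singular_face 1 1 f = b"
proof -
  let ?e = "\<lambda>i j::nat. if j = i then 1 else (0::real)"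
  have "a (?e 0) \<in> topspace Y" "b (?e 0) \<in> topspace Y"
    using a b by (auto simp: singular_simplex_def continuous_map_def standard_simplex_0)
  then obtain g where g: "pathin Y g" "g 0 = b (?e 0)" "g 1 = a (?e 0)"
    using assms(1) unfolding path_connected_space_def by blast
  \<comment> \<open>The coordinate \<open>x 1\<close> runs from 0 at vertex 0 to 1 at vertex 1. Face
    0 omits vertex 0, so the path has to end at \<open>a\<close> and start at
    \<open>b\<close>.\<close>
  define f where "f = restrict (\<lambda>x. g (x 1)) (standard_simplex 1)"
  have "continuous_map (subtopology (powertop_real UNIV) (standard_simplex 1))
      (top_of_set {0..1}) (\<lambda>x. x 1)"
    by (auto simp: continuous_map_in_subtopology standard_simplex_def
        intro: continuous_map_from_subtopology continuous_map_product_projection)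
  then have "continuous_map (subtopology (powertop_real UNIV) (standard_simplex 1)) Y (\<lambda>x. g (x 1))"
    using g(1) continuous_map_compose unfolding pathin_def o_def by blast
  then have f: "singular_simplex 1 Y f"
    unfolding singular_simplex_def f_def by simp
  have face: "singular_face 1 i f (?e 0) = f (?e (1 - i))" if "i \<le> 1" for i
  proof -
    have "simplical_face i (?e 0) = ?e (1 - i)"
      using that by (cases "i = 0") (auto simp: simplical_face_def fun_eq_iff le_Suc_eq)
    then show ?thesis
      by (simp add: singular_face_def)
  qed
  have "singular_face 1 0 f = a"
    using face[of 0] g singular_simplex_singular_face[OF f, of 0] a
    by (intro singular_simplex_0_eqI) (auto simp: f_def)
  moreover have "singular_face 1 1 f = b"
    using face[of 1] g singular_simplex_singular_face[OF f, of 1] b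
    by (intro singular_simplex_0_eqI) (auto simp: f_def)
  ultimately show ?thesis
    using f by blast
qed

text \<open>Based at its own value at \<open>nsphere_base\<close>, \<open>f\<close> has the same
  class as the constant map, because the set of classes is a singleton. The condition on base points
  is then dropped.\<close>

lemma pi_zero_imp_nullhomotopic:
  assumes "k \<ge> 1" "\<not> pi_nonzero k Y" and f: "continuous_map (nsphere k) Y f"
  shows "\<exists>y\<in>topspace Y. homotopic_with (\<lambda>_. True) (nsphere k) Y f (\<lambda>_. y)"
proof -
  define y where "y = f nsphere_base"
  have y: "y \<in> topspace Y"
    using continuous_map_image_subset_topspace[OF f] in_topspace_nsphere[of k]
    by (auto simp: y_def nsphere_base_def)
  let ?A = "based_sphere_maps k Y y"
  let ?R = "{(f, g). f \<in> ?A \<and> g \<in> ?A \<and>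
                homotopic_with (\<lambda>h. h nsphere_base = y) (nsphere k) Y f g}"
  have A: "f \<in> ?A" "(\<lambda>_. y) \<in> ?A"
    using f y by (auto simp: based_sphere_maps_def y_def)
  have "is_singleton (?A // ?R)"
    using assms(1,2) y by (simp add: pi_nonzero_def homotopy_set_def)
  moreover have "?R `` {f} \<in> ?A // ?R" "?R `` {\<lambda>_. y} \<in> ?A // ?R"
    by (rule quotientI, rule A)+
  ultimately have "?R `` {f} = ?R `` {\<lambda>_. y}"
    unfolding is_singleton_def by auto
  moreover have "(\<lambda>_. y) \<in> ?R `` {\<lambda>_. y}"
    using A y by auto
  ultimately have "(\<lambda>_. y) \<in> ?R `` {f}"
    by (simp only:)
  then have "homotopic_with (\<lambda>h. h nsphere_base = y) (nsphere k) Y f (\<lambda>_. y)"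
    by simp
  then have "homotopic_with (\<lambda>_. True) (nsphere k) Y f (\<lambda>_. y)"
    by (rule homotopic_with_mono) simp
  with y show ?thesis by blast
qed

section \<open>The boundary of a simplex as a sphere, and the simplex as a cone over it\<close>

definition simplex_boundary :: "nat \<Rightarrow> (nat \<Rightarrow> real) set"
  where "simplex_boundary n = {x \<in> standard_simplex n. \<exists>i\<le>n. x i = 0}"

lemma simplex_boundary_subset: "simplex_boundary n \<subseteq> standard_simplex n"
  by (auto simp: simplex_boundary_def)

lemma closedin_simplex_face:
  "closedin (powertop_real UNIV) {x \<in> standard_simplex n. x i = 0}"
proof -
  have "closedin (powertop_real UNIV) {x \<in> topspace (powertop_real UNIV). x i \<in> {0}}"
    by (rule closedin_continuous_map_preimage[of _ euclideanreal])
       (auto intro: continuous_map_product_projection)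
  from closedin_Int[OF closedin_standard_simplex[of n] this]
  show ?thesis
    by (simp add: Collect_conj_eq)
qed

lemma compact_simplex_boundary:
  "compact_space (subtopology (powertop_real UNIV) (simplex_boundary n))"
proof -
  have "simplex_boundary n = (\<Union>i\<le>n. {x \<in> standard_simplex n. x i = 0})"
    by (auto simp: simplex_boundary_def)
  then have "closedin (powertop_real UNIV) (simplex_boundary n)"
    using closedin_simplex_face by (auto intro!: closedin_Union)
  then have "compactin (powertop_real UNIV) (simplex_boundary n)"
    using closed_compactin[OF compactin_standard_simplex simplex_boundary_subset] by blast
  then show ?thesis
    by (simp add: compactin_subspace)
qed

lemma Hausdorff_powertop_real: "Hausdorff_space (powertop_real UNIV)"
  by (simp add: Hausdorff_space_product_topology)

text \<open>Subtracting the last coordinate from all others is linear with kernel spanned by (1,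
  ..., 1), so it embeds the simplex in Euclidean space with the barycentre at 0. Normalising is then
  radial projection from the barycentre. As the boundary is compact and the sphere Hausdorff, a
  continuous bijection suffices.\<close>

lemma homeomorphic_map_simplex_boundary_nsphere:
  fixes k :: nat
  defines "N \<equiv> \<lambda>x::nat \<Rightarrow> real. sqrt (\<Sum>j\<le>k. (x j - x (Suc k))\<^sup>2)"
  shows "homeomorphic_map (subtopology (powertop_real UNIV) (simplex_boundary (Suc k))) (nsphere k)
           (\<lambda>x i. if i \<le> k then (x i - x (Suc k)) / N x else 0)"
    (is "homeomorphic_map ?B _ ?s")
proof (rule continuous_imp_homeomorphic_map)
  \<comment> \<open>If \<open>N x\<close> were 0, all coordinates would equal the one that vanishes,
    against their sum being 1.\<close>
  have N: "N x > 0" if x_in: "x \<in> simplex_boundary (Suc k)" for x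
  proof -
    obtain i where i: "i \<le> Suc k" "x i = 0" and x: "x \<in> standard_simplex (Suc k)"
      using x_in by (auto simp: simplex_boundary_def)
    have "(\<Sum>j\<le>k. (x j - x (Suc k))\<^sup>2) \<noteq> 0"
    proof
      assume "(\<Sum>j\<le>k. (x j - x (Suc k))\<^sup>2) = 0"
      then have "\<forall>j\<in>{..k}. (x j - x (Suc k))\<^sup>2 = 0"
        by (subst (asm) sum_nonneg_eq_0_iff) auto
      then have *: "x j = x (Suc k)" if "j \<le> Suc k" for j
        using that by (cases "j = Suc k") auto
      have "x j = 0" if "j \<le> Suc k" for j
        using i(2) *[OF that] *[OF i(1)] by simp
      then have "sum x {..Suc k} = 0" by simp
      with x show False by (simp add: standard_simplex_def del: sum.atMost_Suc)
    qed
    then show ?thesis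
      by (simp add: N_def sum_nonneg order_less_le)
  qed
  have N2: "(N x)\<^sup>2 = (\<Sum>j\<le>k. (x j - x (Suc k))\<^sup>2)" for x
    by (simp add: N_def sum_nonneg)
  have proj: "continuous_map ?B euclideanreal (\<lambda>x. x i)" for i
    by (intro continuous_map_from_subtopology continuous_map_product_projection) auto
  have "continuous_map ?B euclideanreal N"
    unfolding N_def by (intro continuous_intros proj) auto
  then have "continuous_map ?B euclideanreal (\<lambda>x. ?s x i)" for i
    using N[THEN less_imp_neq, symmetric]
    by (cases "i \<le> k") (auto intro!: continuous_map_real_divide continuous_intros proj)
  moreover have "?s x \<in> topspace (nsphere k)" if "x \<in> simplex_boundary (Suc k)" for x
    using N[OF that] by (simp add: nsphere power_divide N2 flip: sum_divide_distrib)
       (metis N2 less_irrefl zero_less_power2)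
  ultimately show "continuous_map ?B (nsphere k) ?s"
    by (auto simp: nsphere continuous_map_in_subtopology continuous_map_componentwise_UNIV)
  show "compact_space ?B"
    by (rule compact_simplex_boundary)
  show "Hausdorff_space (nsphere k)"
    unfolding nsphere by (intro Hausdorff_space_subtopology Hausdorff_powertop_real)
  show "inj_on ?s (topspace ?B)"
  proof (rule inj_onI)
    fix x y assume "x \<in> topspace ?B" "y \<in> topspace ?B" and s: "?s x = ?s y"
    then have xy: "x \<in> simplex_boundary (Suc k)" "y \<in> simplex_boundary (Suc k)"
      by auto
    then obtain i where i: "i \<le> Suc k" "x i = 0"
      by (auto simp: simplex_boundary_def)
    obtain i' where i': "i' \<le> Suc k" "y i' = 0"
      using xy by (auto simp: simplex_boundary_def)
    have nonneg: "x j \<ge> 0" "y j \<ge> 0" for j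
      using xy by (auto simp: simplex_boundary_def standard_simplex_def)
    have sum: "sum x {..Suc k} = 1" "sum y {..Suc k} = 1"
      using xy by (auto simp: simplex_boundary_def standard_simplex_def)
    have eq: "(x j - x (Suc k)) / N x = (y j - y (Suc k)) / N y" if "j \<le> Suc k" for j
      using fun_cong[OF s, of j] that by (cases "j = Suc k") auto
    have d: "(x j - x i) / N x = (y j - y i) / N y" if "j \<le> Suc k" for j
      using eq[OF that] eq[OF i(1)] by (simp add: diff_divide_distrib)
    \<comment> \<open>\<open>x\<close> is smallest at \<open>i\<close>, and the order of coordinates
      is preserved, so \<open>y\<close> is no larger at \<open>i\<close> than at its zero
      \<open>i'\<close>. Once both vanish at \<open>i\<close>, \<open>x\<close> and \<open>y\<close>
      are proportional, and their equal sums give equality.\<close>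
    have "(y i' - y i) / N y \<ge> 0"
      using d[OF i'(1)] i(2) nonneg N[OF xy(1)] by (metis diff_0_right divide_nonneg_pos)
    then have "y i = 0"
      using i'(2) nonneg(2)[of i] N[OF xy(2)] by (simp add: divide_le_0_iff)
    then have d: "x j / N x = y j / N y" if "j \<le> Suc k" for j
      using d[OF that] i(2) by simp
    have "sum x {..Suc k} / N x = sum y {..Suc k} / N y"
      unfolding sum_divide_distrib by (intro sum.cong) (auto simp: d)
    then have "N x = N y"
      unfolding sum by simp
    then have "x j = y j" if "j \<le> Suc k" for j
      using d[OF that] N[OF xy(1)] N[OF xy(2)] by simp
    moreover have "x j = y j" if "j > Suc k" for j
      using that xy by (auto simp: simplex_boundary_def standard_simplex_def)
    ultimately show "x = y"
      by (metis ext linorder_not_less)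
  qed
  show "?s ` topspace ?B = topspace (nsphere k)"
  proof
    show "?s ` topspace ?B \<subseteq> topspace (nsphere k)"
      by (rule continuous_map_image_subset_topspace) fact
    show "topspace (nsphere k) \<subseteq> ?s ` topspace ?B"
    proof
      fix z assume "z \<in> topspace (nsphere k)"
      then have z: "(\<Sum>j\<le>k. (z j)\<^sup>2) = 1" "\<And>i. i > k \<Longrightarrow> z i = 0"
        by (auto simp: nsphere)
      \<comment> \<open>The preimage of \<open>z\<close>, whose coordinate \<open>Suc k\<close> is
        0: subtracting the minimum \<open>m\<close> makes some coordinate vanish, and dividing by
        the sum \<open>U\<close> of the results gives sum 1.\<close>
      define m where "m = Min (z ` {..Suc k})"
      have m: "m \<le> z j" if "j \<le> Suc k" for j
        unfolding m_def by (rule Min_le) (use that in auto)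
      have "m \<in> z ` {..Suc k}"
        unfolding m_def by (intro Min_in) auto
      then obtain i where i: "i \<le> Suc k" "z i = m"
        by auto
      define U where "U = (\<Sum>j\<le>Suc k. z j - m)"
      have "U \<noteq> 0"
      proof
        assume "U = 0"
        then have *: "z j = m" if "j \<le> Suc k" for j
          using that m unfolding U_def by (subst (asm) sum_nonneg_eq_0_iff) auto
        then have "z j = 0" if "j \<le> k" for j
          using z(2)[of "Suc k"] *[of "Suc k"] *[of j] that by simp
        then show False using z(1) by simp
      qed
      moreover have "U \<ge> 0"
        unfolding U_def by (intro sum_nonneg) (use m in auto)
      ultimately have U: "U > 0" by simp
      define x where "x j = (if j \<le> Suc k then (z j - m) / U else 0)" for j
      have x_nonneg: "x j \<ge> 0" for j
        using m[of j] U by (auto simp: x_def)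
      have x_sum: "sum x {..Suc k} = 1"
        using U by (simp add: x_def U_def flip: sum_divide_distrib del: sum.atMost_Suc)
      have "x j \<le> 1" for j
        using member_le_sum[of j "{..Suc k}" x] x_nonneg x_sum
        by (cases "j \<le> Suc k") (auto simp: x_def[of j])
      then have x: "x \<in> simplex_boundary (Suc k)"
        using x_nonneg x_sum i unfolding simplex_boundary_def standard_simplex_def
        by (auto simp: x_def simp del: sum.atMost_Suc intro!: exI[of _ i])
      have diff: "x j - x (Suc k) = z j / U" if "j \<le> k" for j
        using that z(2)[of "Suc k"] by (simp add: x_def diff_divide_distrib)
      have "(N x)\<^sup>2 = (1 / U)\<^sup>2"
        using z(1) by (simp add: N2 diff power_divide flip: sum_divide_distrib)
      then have "N x = 1 / U"
        using N[OF x] U by (simp add: power2_eq_iff_nonneg)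
      then have "?s x = z"
        using U z(2) by (auto simp: diff)
      then show "z \<in> ?s ` topspace ?B"
        using x by force
    qed
  qed
qed

text \<open>Transported to the sphere, \<open>\<phi>\<close> is nullhomotopic. The homotopy is
  constant at time 1, so it descends to the cone over the boundary, which is the simplex with the
  barycentre as apex.\<close>

lemma extend_from_simplex_boundary:
  assumes "k \<ge> 1" "\<not> pi_nonzero k Y"
    and \<phi>: "continuous_map (subtopology (powertop_real UNIV) (simplex_boundary (Suc k))) Y \<phi>"
  shows "\<exists>g. continuous_map (subtopology (powertop_real UNIV) (standard_simplex (Suc k))) Y g \<and>
             (\<forall>x\<in>simplex_boundary (Suc k). g x = \<phi> x)"
proof -
  let ?B = "subtopology (powertop_real UNIV) (simplex_boundary (Suc k))"
  let ?D = "subtopology (powertop_real UNIV) (standard_simplex (Suc k))"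
  let ?I = "top_of_set {0..1::real}"
  obtain s s' where s: "homeomorphic_maps ?B (nsphere k) s s'"
    using homeomorphic_map_simplex_boundary_nsphere[of k] by (auto simp: homeomorphic_map_maps)
  then have cont: "continuous_map ?B (nsphere k) s" "continuous_map (nsphere k) ?B s'"
    and inv: "\<And>x. x \<in> simplex_boundary (Suc k) \<Longrightarrow> s' (s x) = x"
    by (auto simp: homeomorphic_maps_def)
  obtain y where "homotopic_with (\<lambda>_. True) (nsphere k) Y (\<phi> \<circ> s') (\<lambda>_. y)"
    using pi_zero_imp_nullhomotopic[OF assms(1,2) continuous_map_compose[OF cont(2) \<phi>]] by blast
  then have "homotopic_with (\<lambda>_. True) ?B Y ((\<phi> \<circ> s') \<circ> s) ((\<lambda>_. y) \<circ> s)"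
    using cont(1) by (rule homotopic_with_compose_continuous_map_right) simp
  then obtain h where h: "continuous_map (prod_topology ?I ?B) Y h"
    and h0: "\<And>x. h (0, x) = \<phi> (s' (s x))" and h1: "\<And>x. h (1, x) = y"
    unfolding homotopic_with_def by (auto simp: o_def)
  \<comment> \<open>\<open>c\<close> is the value of each of the \<open>k + 2\<close> barycentric
    coordinates of the barycentre; \<open>q\<close> moves \<open>x\<close> to it along a straight
    line.\<close>
  define c where "c = 1 / real (k + 2)"
  have c: "c > 0" "real (k + 2) * c = 1"
    by (simp_all add: c_def)
  define q where "q = (\<lambda>(t, x). \<lambda>i::nat. (1 - t) * x i + (if i \<le> Suc k then t * c else 0))"
  have proj: "continuous_map (prod_topology ?I ?B) euclideanreal fst"
    "continuous_map (prod_topology ?I ?B) euclideanreal (\<lambda>z. snd z i)" for i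
  proof -
    show "continuous_map (prod_topology ?I ?B) euclideanreal fst"
      using continuous_map_fst continuous_map_into_fulltopology by blast
    have "continuous_map ?B euclideanreal (\<lambda>x. x i)"
      by (intro continuous_map_from_subtopology continuous_map_product_projection) auto
    from continuous_map_compose[OF continuous_map_snd this]
    show "continuous_map (prod_topology ?I ?B) euclideanreal (\<lambda>z. snd z i)"
      by (simp add: o_def)
  qed
  have boundaryD: "0 \<le> x i" "x i \<le> 1" "i > Suc k \<Longrightarrow> x i = 0" "sum x {..Suc k} = 1"
    if "x \<in> simplex_boundary (Suc k)" for x i
    using that by (auto simp: simplex_boundary_def standard_simplex_def)
  have simplexI: "x \<in> standard_simplex (Suc k)"
    if nonneg: "\<And>i. 0 \<le> x i" and "\<And>i. i > Suc k \<Longrightarrow> x i = 0" and sum: "sum x {..Suc k} = 1" for x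
  proof -
    have "x i \<le> 1" for i
      using member_le_sum[of i "{..Suc k}" x] nonneg sum that(2)[of i]
      by (cases "i \<le> Suc k") (auto simp del: sum.atMost_Suc)
    with that show ?thesis
      by (simp add: standard_simplex_def)
  qed
  have q_in: "q (t, x) \<in> standard_simplex (Suc k)" if "t \<in> {0..1}" "x \<in> simplex_boundary (Suc k)" for t x
  proof (rule simplexI)
    show "0 \<le> q (t, x) i" for i
      using that boundaryD(1)[OF that(2), of i] c by (auto simp: q_def)
    show "q (t, x) i = 0" if "i > Suc k" for i
      using that boundaryD(3)[OF \<open>x \<in> _\<close>, of i] by (simp add: q_def)
    have "sum (q (t, x)) {..Suc k} = (\<Sum>i\<le>Suc k. (1 - t) * x i + t * c)"
      by (rule sum.cong) (auto simp: q_def)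
    also have "\<dots> = (1 - t) * sum x {..Suc k} + t * (real (k + 2) * c)"
      unfolding sum.distrib sum_distrib_left[symmetric] sum_constant by simp
    finally have "sum (q (t, x)) {..Suc k} = (1 - t) * sum x {..Suc k} + t * (real (k + 2) * c)" .
    then show "sum (q (t, x)) {..Suc k} = 1"
      using boundaryD(4)[OF that(2)] c(2) by simp
  qed
  have q_cont: "continuous_map (prod_topology ?I ?B) ?D q"
  proof -
    have "continuous_map (prod_topology ?I ?B) euclideanreal (\<lambda>z. q z i)" for i
      unfolding q_def case_prod_beta
      by (intro continuous_map_add continuous_map_real_mult continuous_map_diff proj)
         (auto intro!: continuous_map_real_mult_right proj)
    then show ?thesis
      using q_in by (auto simp: continuous_map_in_subtopology continuous_map_componentwise_UNIV)
  qed
  have q_surj: "\<exists>t x. t \<in> {0..1} \<and> x \<in> simplex_boundary (Suc k) \<and> q (t, x) = z"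
    if z_in: "z \<in> standard_simplex (Suc k)" for z
  proof -
    have z: "0 \<le> z i" "i > Suc k \<Longrightarrow> z i = 0" "sum z {..Suc k} = 1" for i
      using z_in by (auto simp: standard_simplex_def)
    define m where "m = Min (z ` {..Suc k})"
    have m: "m \<le> z j" if "j \<le> Suc k" for j
      unfolding m_def by (rule Min_le) (use that in auto)
    have "m \<in> z ` {..Suc k}"
      unfolding m_def by (intro Min_in) auto
    then obtain i where i: "i \<le> Suc k" "z i = m"
      by auto
    \<comment> \<open>On the segment through a boundary point the smallest coordinate at time
      \<open>t\<close> is \<open>t * c\<close>, which determines \<open>t\<close> from the minimum
      \<open>m\<close>.\<close>
    define t where "t = real (k + 2) * m"
    have tc: "t * c = m"
      by (simp add: t_def c_def)
    have sum_diff: "(\<Sum>j\<le>Suc k. z j - m) = 1 - t"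
      using z(3) by (simp add: sum_subtractf t_def algebra_simps)
    have "(\<Sum>j\<le>Suc k. z j - m) \<ge> 0"
      by (intro sum_nonneg) (use m in auto)
    then have t: "t \<in> {0..1}"
      using sum_diff z(1)[of i] i(2) by (simp add: t_def)
    show ?thesis
    proof (cases "t = 1")
      case True
      then have "(\<Sum>j\<le>Suc k. z j - m) = 0"
        using sum_diff by simp
      then have "\<forall>j\<in>{..Suc k}. z j - m = 0"
        using m by (subst (asm) sum_nonneg_eq_0_iff) auto
      \<comment> \<open>Here \<open>z\<close> is the barycentre, so any boundary point will do;
        vertex 0 is taken.\<close>
      then have "q (t, \<lambda>j. if j = 0 then 1 else 0) = z"
        using True tc z(2) by (auto simp: q_def fun_eq_iff)
      moreover have "(\<lambda>j. if j = 0 then 1 else 0) \<in> simplex_boundary (Suc k)"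
        by (auto simp: simplex_boundary_def intro: exI[of _ "Suc k"])
      ultimately show ?thesis
        using t by blast
    next
      case False
      then have t1: "1 - t > 0" using t by simp
      define x where "x j = (if j \<le> Suc k then (z j - m) / (1 - t) else 0)" for j
      have "x \<in> standard_simplex (Suc k)"
      proof (rule simplexI)
        show "0 \<le> x j" for j
          using m[of j] t1 by (auto simp: x_def)
        show "x j = 0" if "j > Suc k" for j
          using that by (simp add: x_def)
        have "sum x {..Suc k} = (\<Sum>j\<le>Suc k. z j - m) / (1 - t)"
          unfolding sum_divide_distrib by (rule sum.cong) (auto simp: x_def)
        then show "sum x {..Suc k} = 1"
          using sum_diff t1 by (simp del: sum.atMost_Suc)
      qed
      then have "x \<in> simplex_boundary (Suc k)"
        using i by (auto simp: simplex_boundary_def x_def)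
      moreover have "q (t, x) = z"
        using t1 z(2) by (auto simp: q_def fun_eq_iff x_def tc)
      ultimately show ?thesis
        using t by blast
    qed
  qed
  have quot: "quotient_map (prod_topology ?I ?B) ?D q"
  proof (rule continuous_imp_quotient_map[OF q_cont])
    show "compact_space (prod_topology ?I ?B)"
      by (simp add: compact_space_prod_topology compact_simplex_boundary compact_space_subtopology)
    show "Hausdorff_space ?D"
      by (intro Hausdorff_space_subtopology Hausdorff_powertop_real)
    show "q ` topspace (prod_topology ?I ?B) = topspace ?D"
    proof
      show "q ` topspace (prod_topology ?I ?B) \<subseteq> topspace ?D"
        using q_in by auto
      show "topspace ?D \<subseteq> q ` topspace (prod_topology ?I ?B)"
      proof
        fix z assume "z \<in> topspace ?D"
        then obtain t x where "t \<in> {0..1}" "x \<in> simplex_boundary (Suc k)" "q (t, x) = z"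
          using q_surj[of z] by auto
        then show "z \<in> q ` topspace (prod_topology ?I ?B)"
          by (intro image_eqI[of _ _ "(t, x)"]) auto
      qed
    qed
  qed
  \<comment> \<open>At a zero of \<open>x\<close> the common image has coordinate
    \<open>t * c\<close>, while all its coordinates are at least \<open>t' * c\<close>. By symmetry
    the image determines the time.\<close>
  have t_le: "t' \<le> t"
    if x: "x \<in> simplex_boundary (Suc k)" and x': "x' \<in> simplex_boundary (Suc k)"
      and t': "t' \<in> {0..1}" and eq: "q (t, x) = q (t', x')" for t t' x x'
  proof -
    obtain i where i: "i \<le> Suc k" "x i = 0"
      using x by (auto simp: simplex_boundary_def)
    have "t * c = (1 - t') * x' i + t' * c"
      using fun_cong[OF eq, of i] i by (simp add: q_def)
    moreover have "(1 - t') * x' i \<ge> 0"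
      using t' boundaryD(1)[OF x'] by simp
    ultimately show ?thesis
      using c(1) by (metis add_le_cancel_right add_0 mult_le_cancel_right_pos)
  qed
  \<comment> \<open>Points with equal image coincide except at time 1, where \<open>h\<close> has
    the single value \<open>y\<close>.\<close>
  have "h z = h z'" if z: "z \<in> topspace (prod_topology ?I ?B)" "z' \<in> topspace (prod_topology ?I ?B)"
      and q_eq: "q z = q z'" for z z'
  proof -
    obtain t x t' x' where zz: "z = (t, x)" "z' = (t', x')"
      by (cases z, cases z')
    with z have tx: "t \<in> {0..1}" "t' \<in> {0..1}" "x \<in> simplex_boundary (Suc k)" "x' \<in> simplex_boundary (Suc k)"
      by auto
    have t: "t = t'"
      using t_le[OF tx(3,4,2), of t] t_le[OF tx(4,3,1), of t'] q_eq by (auto simp: zz)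
    show ?thesis
    proof (cases "t = 1")
      case True
      then show ?thesis using t by (simp add: zz h1)
    next
      case False
      have "x j = x' j" for j
        using fun_cong[OF q_eq, of j] False by (simp add: zz t q_def)
      then have "x = x'" by (rule ext)
      then show ?thesis
        by (simp add: zz t)
    qed
  qed
  with quotient_map_lift_exists[OF quot h] obtain g where g: "continuous_map ?D Y g"
    and gq: "\<And>z. z \<in> topspace (prod_topology ?I ?B) \<Longrightarrow> g (q z) = h z"
    by metis
  have "g x = \<phi> x" if "x \<in> simplex_boundary (Suc k)" for x
  proof -
    have "q (0, x) = x"
      by (auto simp: q_def)
    then show ?thesis
      using gq[of "(0, x)"] that inv[OF that] by (simp add: h0)
  qed
  with g show ?thesis by blast
qed

section \<open>Gluing singular simplices along their faces\<close>

definition delete_coord :: "nat \<Rightarrow> (nat \<Rightarrow> 'a) \<Rightarrow> nat \<Rightarrow> 'a"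
  where "delete_coord i x j = (if j < i then x j else x (Suc j))"

lemma simplical_face_delete_coord: "x i = 0 \<Longrightarrow> simplical_face i (delete_coord i x) = x"
  by (auto simp: simplical_face_def delete_coord_def fun_eq_iff)

lemma delete_coord_simplical_face: "delete_coord i (simplical_face i x) = x"
  by (auto simp: simplical_face_def delete_coord_def fun_eq_iff)

lemma delete_coord_in_standard_simplex:
  assumes "x \<in> standard_simplex (Suc k)" "x i = 0" "i \<le> Suc k"
  shows "delete_coord i x \<in> standard_simplex k"
proof -
  have "sum (delete_coord i x) {..k} = sum x ({..Suc k} - {i})"
    by (rule sum.reindex_bij_witness[of _ "\<lambda>j. if j < i then j else j - 1" "\<lambda>j. if j < i then j else Suc j"])
       (use assms(3) in \<open>auto simp: delete_coord_def\<close>)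
  also have "\<dots> = sum x {..Suc k}"
    using assms by (subst sum_diff1) auto
  finally show ?thesis
    using assms by (auto simp: standard_simplex_def delete_coord_def simp del: sum.atMost_Suc)
qed

text \<open>By the compatibility the maps \<open>\<tau> i\<close> agree on intersections of faces.
  They paste over the finitely many closed faces to a map on the boundary, which extends because the
  homotopy group vanishes.\<close>

lemma singular_simplex_extension:
  assumes "k \<ge> 1" "\<not> pi_nonzero k Y"
    and \<tau>: "\<And>i. i \<le> Suc k \<Longrightarrow> singular_simplex k Y (\<tau> i)"
    and compat: "\<And>i j. \<lbrakk>i < j; j \<le> Suc k\<rbrakk> \<Longrightarrow> singular_face k i (\<tau> j) = singular_face k (j - 1) (\<tau> i)"
  shows "\<exists>f. singular_simplex (Suc k) Y f \<and> (\<forall>i\<le>Suc k. singular_face (Suc k) i f = \<tau> i)"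
proof -
  let ?P = "powertop_real UNIV"
  let ?B = "subtopology ?P (simplex_boundary (Suc k))"
  define F where "F i = {x \<in> standard_simplex (Suc k). x i = 0}" for i
  define \<sigma> where "\<sigma> i x = \<tau> i (delete_coord i x)" for i x
  have FB: "F i \<subseteq> simplex_boundary (Suc k)" if "i \<le> Suc k" for i
    using that by (auto simp: F_def simplex_boundary_def)
  have closed: "closedin ?B (F i)" if "i \<le> Suc k" for i
    using closedin_subset_topspace[OF closedin_simplex_face FB[OF that, unfolded F_def]]
    by (simp add: F_def)
  have del: "delete_coord i x \<in> standard_simplex k" if "x \<in> F i" "i \<le> Suc k" for i x
    using that delete_coord_in_standard_simplex by (auto simp: F_def)
  have cont: "continuous_map (subtopology ?B (F i)) Y (\<sigma> i)" if i: "i \<le> Suc k" for i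
  proof -
    have "continuous_map (subtopology ?P (F i)) euclideanreal (\<lambda>x. delete_coord i x j)" for j
      unfolding delete_coord_def
      by (intro continuous_map_from_subtopology) (auto intro: continuous_map_product_projection)
    then have "continuous_map (subtopology ?P (F i)) (subtopology ?P (standard_simplex k)) (delete_coord i)"
      using del i by (auto simp: continuous_map_in_subtopology continuous_map_componentwise_UNIV)
    moreover have "continuous_map (subtopology ?P (standard_simplex k)) Y (\<tau> i)"
      using \<tau>[OF i] by (simp add: singular_simplex_def)
    ultimately have "continuous_map (subtopology ?P (F i)) Y (\<tau> i \<circ> delete_coord i)"
      by (rule continuous_map_compose)
    moreover have "subtopology ?B (F i) = subtopology ?P (F i)"
      using FB[OF i] by (simp add: subtopology_subtopology Int_absorb1)
    moreover have "\<sigma> i = \<tau> i \<circ> delete_coord i"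
      by (simp add: \<sigma>_def fun_eq_iff)
    ultimately show ?thesis
      by (simp only:)
  qed
  have agree_less: "\<sigma> i x = \<sigma> j x" if ij: "i < j" "j \<le> Suc k" and x: "x \<in> F i" "x \<in> F j" for i j x
  proof -
    \<comment> \<open>\<open>u\<close> is the point \<open>x\<close> in the coordinates of the
      common face of codimension two; both values at \<open>x\<close> are read off there.\<close>
    define u where "u = delete_coord i (delete_coord j x)"
    have "delete_coord j x i = 0"
      using x(1) ij by (simp add: delete_coord_def F_def)
    moreover have "delete_coord j x \<in> standard_simplex (Suc (k - 1))"
      using del[OF x(2) ij(2)] \<open>k \<ge> 1\<close> by simp
    ultimately have u: "u \<in> standard_simplex (k - 1)" "simplical_face i u = delete_coord j x"
      using delete_coord_in_standard_simplex[of "delete_coord j x" "k - 1" i]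
        simplical_face_delete_coord[of "delete_coord j x" i] ij \<open>k \<ge> 1\<close>
      unfolding u_def by auto
    have "u = delete_coord (j - 1) (delete_coord i x)"
      using ij by (auto simp: u_def delete_coord_def fun_eq_iff)
    moreover have "delete_coord i x (j - 1) = 0"
      using x(2) ij by (simp add: delete_coord_def F_def)
    ultimately have u': "simplical_face (j - 1) u = delete_coord i x"
      by (simp add: simplical_face_delete_coord)
    from fun_cong[OF compat[OF ij], of u] show ?thesis
      using u u' by (simp add: singular_face_def \<sigma>_def)
  qed
  have agree: "\<sigma> i x = \<sigma> j x" if "i \<in> {..Suc k}" "j \<in> {..Suc k}" "x \<in> topspace ?B \<inter> F i \<inter> F j" for i j x
  proof (cases i j rule: linorder_cases)
    case less
    then show ?thesis using that by (intro agree_less) auto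
  next
    case greater
    then show ?thesis using that by (intro agree_less[symmetric]) auto
  qed simp
  have cover: "topspace ?B \<subseteq> \<Union> (F ` {..Suc k})"
    by (auto simp: simplex_boundary_def F_def)
  obtain \<phi> where \<phi>: "continuous_map ?B Y \<phi>"
      "\<And>x i. \<lbrakk>i \<in> {..Suc k}; x \<in> topspace ?B \<inter> F i\<rbrakk> \<Longrightarrow> \<phi> x = \<sigma> i x"
  proof (rule pasting_lemma_exists_closed)
    show "topspace ?B \<subseteq> \<Union> (F ` {..Suc k})"
      by (fact cover)
    show "\<sigma> i x = \<sigma> j x"
      if "i \<in> {..Suc k}" "j \<in> {..Suc k}" "x \<in> topspace ?B \<inter> F i \<inter> F j" for i j x
      using that by (rule agree)
    show "closedin ?B (F i)" "continuous_map (subtopology ?B (F i)) Y (\<sigma> i)" if "i \<in> {..Suc k}" for i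
      using that closed cont by simp_all
  qed blast+
  obtain g where g: "continuous_map (subtopology ?P (standard_simplex (Suc k))) Y g"
    "\<And>x. x \<in> simplex_boundary (Suc k) \<Longrightarrow> g x = \<phi> x"
    using extend_from_simplex_boundary[OF assms(1,2) \<phi>(1)] by blast
  define f where "f = restrict g (standard_simplex (Suc k))"
  have f: "singular_simplex (Suc k) Y f"
    using g(1) by (simp add: f_def singular_simplex_def)
  moreover have "singular_face (Suc k) i f = \<tau> i" if i: "i \<le> Suc k" for i
  proof (rule extensionalityI)
    show "singular_face (Suc k) i f \<in> extensional (standard_simplex k)"
      by (simp add: singular_face_def)
    show "\<tau> i \<in> extensional (standard_simplex k)"
      using \<tau>[OF i] by (simp add: singular_simplex_def)
    fix y assume y: "y \<in> standard_simplex k"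
    have "simplical_face i y \<in> standard_simplex (Suc k)"
      using y i by (intro simplical_face_in_standard_simplex) auto
    moreover from this have "simplical_face i y \<in> F i"
      by (simp add: F_def simplical_face_def)
    ultimately show "singular_face (Suc k) i f y = \<tau> i y"
      using y g(2)[of "simplical_face i y"] \<phi>(2)[of i "simplical_face i y"] FB[OF i] i
      by (auto simp: singular_face_def f_def \<sigma>_def delete_coord_simplical_face)
  qed
  ultimately show ?thesis by blast
qed

subsection \<open>Vanishing homotopy groups and singular cycles\<close>

lemma singular_face_singular_face:
  assumes "i < j" "j \<le> Suc (Suc k)"
  shows "singular_face (Suc k) i (singular_face (Suc (Suc k)) j f) =
         singular_face (Suc k) (j - 1) (singular_face (Suc (Suc k)) i f)"
proof
  fix x :: "nat \<Rightarrow> real"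
  show "singular_face (Suc k) i (singular_face (Suc (Suc k)) j f) x =
         singular_face (Suc k) (j - 1) (singular_face (Suc (Suc k)) i f) x"
  proof (cases "x \<in> standard_simplex k")
    case True
    then have "simplical_face i x \<in> standard_simplex (Suc k)"
      "simplical_face (j - 1) x \<in> standard_simplex (Suc k)"
      using assms by (auto intro!: simplical_face_in_standard_simplex)
    moreover have "simplical_face j (simplical_face i x) = simplical_face i (simplical_face (j - 1) x)"
      using assms by (auto simp: simplical_face_def fun_eq_iff)
    ultimately show ?thesis
      using True by (simp add: singular_face_def)
  qed (simp add: singular_face_def)
qed

text \<open>
  A contraction of the singular complex of \<open>Y\<close> below its first nonzero homotopy group.  The choices
  exist only there; elsewhere the values are arbitrary.
\<close>
primrec singular_cone ::
    "'a topology \<Rightarrow> ((nat \<Rightarrow> real) \<Rightarrow> 'a) \<Rightarrow> nat \<Rightarrow> ((nat \<Rightarrow> real) \<Rightarrow> 'a) \<Rightarrow> (nat \<Rightarrow> real) \<Rightarrow> 'a"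
  where
    "singular_cone Y b 0 = (\<lambda>f. SOME g. singular_simplex 1 Y g \<and>
        singular_face 1 0 g = f \<and> singular_face 1 1 g = b)"
  | "singular_cone Y b (Suc k) = (\<lambda>f. SOME g. singular_simplex (Suc (Suc k)) Y g \<and>
        singular_face (Suc (Suc k)) 0 g = f \<and>
        (\<forall>i\<le>Suc k. singular_face (Suc (Suc k)) (Suc i) g =
           singular_cone Y b k (singular_face (Suc k) i f)))"

text \<open>The prescribed faces are \<open>f\<close> and the cones over the faces of
  \<open>f\<close>. They fit together by the simplicial identities and the face formulas one degree
  lower, so the extension lemma fills them. Hence all four claims are proved in one induction,
  starting with a path from \<open>b\<close>.\<close>

lemma singular_cone:
  assumes "\<And>i. i \<le> k \<Longrightarrow> \<not> pi_nonzero i Y" and b: "singular_simplex 0 Y b"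
    and "singular_simplex k Y f"
  shows "singular_simplex (Suc k) Y (singular_cone Y b k f)"
    and "singular_face (Suc k) 0 (singular_cone Y b k f) = f"
    and "k = 0 \<Longrightarrow> singular_face 1 1 (singular_cone Y b 0 f) = b"
    and "\<And>i. \<lbrakk>k > 0; i \<le> k\<rbrakk> \<Longrightarrow> singular_face (Suc k) (Suc i) (singular_cone Y b k f) =
          singular_cone Y b (k - 1) (singular_face k i f)"
proof -
  have "singular_simplex (Suc k) Y (singular_cone Y b k f) \<and>
    singular_face (Suc k) 0 (singular_cone Y b k f) = f \<and>
    (k = 0 \<longrightarrow> singular_face 1 1 (singular_cone Y b 0 f) = b) \<and>
    (\<forall>i. k > 0 \<longrightarrow> i \<le> k \<longrightarrow> singular_face (Suc k) (Suc i) (singular_cone Y b k f) =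
          singular_cone Y b (k - 1) (singular_face k i f))"
    using assms(1,3)
  proof (induction k arbitrary: f)
    case 0
    have "path_connected_space Y"
      using 0(1)[of 0] by (simp add: pi_nonzero_def)
    then have "\<exists>g. singular_simplex 1 Y g \<and> singular_face 1 0 g = f \<and> singular_face 1 1 g = b"
      using 0(2) b by (rule singular_simplex_path)
    from someI_ex[OF this] show ?case
      by simp
  next
    case (Suc k)
    define \<tau> where "\<tau> i = (case i of 0 \<Rightarrow> f | Suc i' \<Rightarrow> singular_cone Y b k (singular_face (Suc k) i' f))" for i
    have face: "singular_simplex k Y (singular_face (Suc k) i f)" if "i \<le> Suc k" for i
      using singular_simplex_singular_face[OF Suc.prems(2), of i] that by simp
    have IH: "singular_simplex (Suc k) Y (singular_cone Y b k h)"
      "singular_face (Suc k) 0 (singular_cone Y b k h) = h"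
      "k = 0 \<Longrightarrow> singular_face 1 1 (singular_cone Y b 0 h) = b"
      "\<And>i. \<lbrakk>k > 0; i \<le> k\<rbrakk> \<Longrightarrow> singular_face (Suc k) (Suc i) (singular_cone Y b k h) =
          singular_cone Y b (k - 1) (singular_face k i h)"
      if "singular_simplex k Y h" for h
      using Suc.IH[OF _ that] Suc.prems(1) by auto
    have "\<exists>g. singular_simplex (Suc (Suc k)) Y g \<and>
        (\<forall>i\<le>Suc (Suc k). singular_face (Suc (Suc k)) i g = \<tau> i)"
    proof (rule singular_simplex_extension)
      show "\<not> pi_nonzero (Suc k) Y"
        using Suc.prems(1) by simp
      show "singular_simplex (Suc k) Y (\<tau> i)" if "i \<le> Suc (Suc k)" for i
        using that face IH(1) Suc.prems(2) by (cases i) (auto simp: \<tau>_def)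
      show "singular_face (Suc k) i (\<tau> j) = singular_face (Suc k) (j - 1) (\<tau> i)"
        if ij: "i < j" "j \<le> Suc (Suc k)" for i j
      proof -
        obtain j' where j: "j = Suc j'"
          using ij by (cases j) auto
        show ?thesis
        proof (cases i)
          case 0
          then show ?thesis
            using ij IH(2) face by (simp add: j \<tau>_def)
        next
          case (Suc i')
          show ?thesis
          proof (cases "k = 0")
            \<comment> \<open>Here \<open>f\<close> is an edge, and the two paths coned over its end
              points meet in \<open>b\<close>.\<close>
            case True
            then have "i' = 0" "j' = 1"
              using ij Suc j by auto
            then show ?thesis
              using IH(3)[OF face] True by (simp add: j Suc \<tau>_def)
          next
            case False
            then obtain k' where k: "k = Suc k'"
              by (cases k) auto
            have "singular_face k i' (singular_face (Suc k) j' f) =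
                singular_face k (j' - 1) (singular_face (Suc k) i' f)"
              using singular_face_singular_face[of i' j' k' f] ij Suc j by (simp add: k)
            moreover have "singular_face (Suc k) (Suc i') (\<tau> j) =
                singular_cone Y b (k - 1) (singular_face k i' (singular_face (Suc k) j' f))"
              using IH(4)[OF face[of j'], of i'] ij Suc j False by (simp add: \<tau>_def)
            moreover have "singular_face (Suc k) (Suc (j' - 1)) (\<tau> (Suc i')) =
                singular_cone Y b (k - 1) (singular_face k (j' - 1) (singular_face (Suc k) i' f))"
              using IH(4)[OF face[of i'], of "j' - 1"] ij Suc j False by (simp add: \<tau>_def)
            moreover have "Suc (j' - 1) = j - 1"
              using ij Suc j by simp
            ultimately show ?thesis
              using Suc by simp
          qed
        qed
      qed
    qed simp
    then have "\<exists>g. singular_simplex (Suc (Suc k)) Y g \<and>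
        singular_face (Suc (Suc k)) 0 g = f \<and>
        (\<forall>i\<le>Suc k. singular_face (Suc (Suc k)) (Suc i) g =
           singular_cone Y b k (singular_face (Suc k) i f))"
      by (force simp: \<tau>_def)
    from someI_ex[OF this] show ?case
      by simp
  qed
  then show "singular_simplex (Suc k) Y (singular_cone Y b k f)"
    and "singular_face (Suc k) 0 (singular_cone Y b k f) = f"
    and "k = 0 \<Longrightarrow> singular_face 1 1 (singular_cone Y b 0 f) = b"
    and "\<And>i. \<lbrakk>k > 0; i \<le> k\<rbrakk> \<Longrightarrow> singular_face (Suc k) (Suc i) (singular_cone Y b k f) =
          singular_cone Y b (k - 1) (singular_face k i f)"
    by blast+
qed

text \<open>Each point contributes a path from \<open>b\<close>, so the point \<open>b\<close> is
  subtracted as often as the augmentation says.\<close>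

lemma chain_boundary_singular_cone_0:
  assumes "\<not> pi_nonzero 0 Y" "singular_simplex 0 Y b" "singular_chain 0 Y c"
  shows "chain_boundary 1 (frag_extend (frag_of \<circ> singular_cone Y b 0) c) =
    c - frag_cmul (cochain_eval 0 (\<lambda>_. 1) c) (frag_of b)"
  using assms(3) unfolding singular_chain_def
proof (induction c rule: frag_induction)
  case (one f)
  then show ?case
    using singular_cone(2,3)[of 0 Y b f] assms by (simp add: chain_boundary_of)
next
  case (diff a c)
  then show ?case
    by (simp add: frag_extend_diff chain_boundary_diff cochain_eval_diff frag_cmul_diff_distrib)
qed simp

text \<open>The identity of a contracting homotopy: face 0 of a cone returns the simplex, and the
  other faces are the cones over its faces with their signs reversed by the shift of index.\<close>

lemma chain_boundary_singular_cone_Suc: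
  assumes "\<And>i. i \<le> Suc k \<Longrightarrow> \<not> pi_nonzero i Y" "singular_simplex 0 Y b"
    and "singular_chain (Suc k) Y c"
  shows "chain_boundary (Suc (Suc k)) (frag_extend (frag_of \<circ> singular_cone Y b (Suc k)) c) =
    c - frag_extend (frag_of \<circ> singular_cone Y b k) (chain_boundary (Suc k) c)"
  using assms(3) unfolding singular_chain_def
proof (induction c rule: frag_induction)
  case (one f)
  then have f: "singular_simplex (Suc k) Y f" by simp
  have "chain_boundary (Suc (Suc k)) (frag_of (singular_cone Y b (Suc k) f)) =
      (\<Sum>i\<le>Suc (Suc k). frag_cmul ((-1) ^ i)
         (frag_of (singular_face (Suc (Suc k)) i (singular_cone Y b (Suc k) f))))"
    by (simp add: chain_boundary_of del: sum.atMost_Suc)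
  also have "\<dots> = frag_of f + (\<Sum>i\<le>Suc k. frag_cmul ((-1) ^ Suc i)
         (frag_of (singular_face (Suc (Suc k)) (Suc i) (singular_cone Y b (Suc k) f))))"
    using singular_cone(2)[OF assms(1,2) f]
    by (subst sum.atMost_Suc_shift) (simp del: singular_cone.simps)
  also have "(\<Sum>i\<le>Suc k. frag_cmul ((-1) ^ Suc i)
         (frag_of (singular_face (Suc (Suc k)) (Suc i) (singular_cone Y b (Suc k) f)))) =
      (\<Sum>i\<le>Suc k. frag_cmul ((-1) ^ Suc i)
         (frag_of (singular_cone Y b k (singular_face (Suc k) i f))))"
    using singular_cone(4)[OF assms(1,2) f]
    by (intro sum.cong refl) (simp del: singular_cone.simps)
  also have "\<dots> = - frag_extend (frag_of \<circ> singular_cone Y b k) (chain_boundary (Suc k) (frag_of f))"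
    by (simp add: chain_boundary_of frag_extend_sum frag_extend_cmul o_def
        del: sum.atMost_Suc singular_cone.simps flip: sum_negf)
  finally show ?case
    by (simp add: o_def del: singular_cone.simps)
next
  case (diff a c)
  then show ?case
    by (simp add: frag_extend_diff chain_boundary_diff del: singular_cone.simps)
qed simp

text \<open>The cone over a cycle bounds it; in degree 0 the vanishing augmentation removes the
  multiple of \<open>b\<close>.\<close>

lemma singular_cycle_bounds:
  assumes "\<And>i. i \<le> k \<Longrightarrow> \<not> pi_nonzero i Y" and "singular_simplex 0 Y b"
    and c: "singular_chain k Y c"
    and "k = 0 \<Longrightarrow> cochain_eval 0 (\<lambda>_. 1) c = 0" and "chain_boundary k c = 0"
  obtains d where "singular_chain (Suc k) Y d" "chain_boundary (Suc k) d = c"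
proof
  let ?d = "frag_extend (frag_of \<circ> singular_cone Y b k) c"
  show "singular_chain (Suc k) Y ?d"
    using c singular_cone(1)[OF assms(1,2)]
    by (intro singular_chain_extend) (auto simp: singular_chain_def simp del: singular_cone.simps)
  show "chain_boundary (Suc k) ?d = c"
  proof (cases k)
    case 0
    then show ?thesis
      using chain_boundary_singular_cone_0[of Y b c] assms by simp
  next
    case (Suc k')
    then show ?thesis
      using chain_boundary_singular_cone_Suc[of k' Y b c] assms by simp
  qed
qed

section \<open>Chains realising the periodic resolution\<close>

lemma chain_map_funpow_Suc:
  "chain_map k T (chain_map k (T ^^ a) c) = chain_map k (T ^^ Suc a) c"
  by (simp add: chain_map_compose)

lemma chain_map_funpow_Suc':
  "chain_map k (T ^^ a) (chain_map k T c) = chain_map k (T ^^ Suc a) c"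
  by (simp only: funpow_Suc_right chain_map_compose o_apply)

text \<open>Starting from a point, each \<open>w (Suc k)\<close> fills
  \<open>equivariant_boundary p T k (w k)\<close>. This is a cycle because \<open>T - 1\<close> and
  the norm multiply to \<open>T ^^ p - 1\<close>, in either order, and this is 0 on
  \<open>Y\<close>.\<close>

lemma resolution_chains_exist:
  assumes conn: "\<And>i. i < n \<Longrightarrow> \<not> pi_nonzero i Y" and "b \<in> topspace Y"
    and T: "continuous_map Y Y T" and period: "\<And>x. x \<in> topspace Y \<Longrightarrow> (T ^^ p) x = x"
  shows "\<exists>w. resolution_chains p T Y n w"
proof -
  define b0 where "b0 = restrict (\<lambda>_. b) (standard_simplex 0)"
  have b0: "singular_simplex 0 Y b0"
    using \<open>b \<in> topspace Y\<close> by (simp add: singular_simplex_def b0_def)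
  have T_pow: "continuous_map Y Y (T ^^ a)" for a
    by (induction a) (simp_all add: continuous_map_compose[OF _ T, unfolded o_def] o_def)
  have chain: "singular_chain k Y (equivariant_boundary p T k c)" if "singular_chain k Y c" for k c
    using that T T_pow unfolding equivariant_boundary_def
    by (auto intro!: singular_chain_diff singular_chain_sum singular_chain_chain_map)
  have telescope: "(\<Sum>a<p. chain_map k (T ^^ Suc a) c - chain_map k (T ^^ a) c) = 0"
    if "singular_chain k Y c" for k c
  proof -
    have "(\<Sum>a<p. chain_map k (T ^^ Suc a) c - chain_map k (T ^^ a) c) =
        chain_map k (T ^^ p) c - chain_map k (T ^^ 0) c"
      by (rule sum_lessThan_telescope)
    also have "\<dots> = 0"
      using chain_map_id_gen[OF that, of "T ^^ p"] chain_map_id_gen[OF that, of "T ^^ 0"] period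
      by simp
    finally show ?thesis .
  qed
  \<comment> \<open>The choice lets \<open>w\<close> be defined by plain recursion; that the
    fillings exist is established along the induction on the degree.\<close>
  define fill where "fill k c = (SOME d. singular_chain (Suc k) Y d \<and> chain_boundary (Suc k) d = c)" for k c
  define w where "w = rec_nat (frag_of b0) (\<lambda>k c. fill k (equivariant_boundary p T k c))"
  have w_0: "w 0 = frag_of b0" and w_Suc: "w (Suc k) = fill k (equivariant_boundary p T k (w k))" for k
    by (simp_all add: w_def)
  have fill: "singular_chain (Suc k) Y (w (Suc k)) \<and>
      chain_boundary (Suc k) (w (Suc k)) = equivariant_boundary p T k (w k)"
    if "k < n" "singular_chain k Y (w k)"
      "k = 0 \<Longrightarrow> cochain_eval 0 (\<lambda>_. 1) (equivariant_boundary p T k (w k)) = 0"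
      "chain_boundary k (equivariant_boundary p T k (w k)) = 0" for k
  proof -
    have "\<exists>d. singular_chain (Suc k) Y d \<and> chain_boundary (Suc k) d = equivariant_boundary p T k (w k)"
      using singular_cycle_bounds[OF _ b0 chain[OF that(2)] that(3,4)] conn that(1)
      by (metis le_less_trans)
    from someI_ex[OF this] show ?thesis
      by (simp add: w_Suc fill_def)
  qed
  have w: "(\<forall>j\<le>k. singular_chain j Y (w j)) \<and>
      (\<forall>j<k. chain_boundary (Suc j) (w (Suc j)) = equivariant_boundary p T j (w j))" if "k \<le> n" for k
    using that
  proof (induction k)
    case 0
    then show ?case using b0 by (simp add: w_0 singular_chain_of)
  next
    case (Suc k)
    then have IH: "singular_chain k Y (w k)"
      "\<And>j. j < k \<Longrightarrow> chain_boundary (Suc j) (w (Suc j)) = equivariant_boundary p T j (w j)"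
      by auto
    have cycle: "chain_boundary k (equivariant_boundary p T k (w k)) = 0"
    proof (cases k)
      case 0
      then show ?thesis by (simp add: chain_boundary_def)
    next
      case k: (Suc j)
      have wj: "singular_chain j Y (w j)"
        using Suc k by auto
      have natural: "chain_boundary k (chain_map k f (w k)) =
          chain_map j f (equivariant_boundary p T j (w j))" for f :: "'a \<Rightarrow> 'a"
        using chain_boundary_chain_map[OF IH(1), of f] IH(2)[of j] by (simp add: k)
      show ?thesis
      proof (cases "even k")
        case True
        then have "chain_boundary k (equivariant_boundary p T k (w k)) =
            chain_map j T (\<Sum>a<p. chain_map j (T ^^ a) (w j)) - (\<Sum>a<p. chain_map j (T ^^ a) (w j))"
          using natural[of T] IH(2)[of j]
          by (simp add: equivariant_boundary_def chain_boundary_diff k)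
        also have "\<dots> = (\<Sum>a<p. chain_map j (T ^^ Suc a) (w j) - chain_map j (T ^^ a) (w j))"
          by (simp only: chain_map_sum finite_lessThan o_def chain_map_funpow_Suc sum_subtractf)
        also have "\<dots> = 0" by (rule telescope[OF wj])
        finally show ?thesis .
      next
        case False
        then have "chain_boundary k (equivariant_boundary p T k (w k)) =
            (\<Sum>a<p. chain_map j (T ^^ a) (chain_map j T (w j) - w j))"
          using natural by (simp add: equivariant_boundary_def chain_boundary_sum o_def k)
        also have "\<dots> = (\<Sum>a<p. chain_map j (T ^^ Suc a) (w j) - chain_map j (T ^^ a) (w j))"
          by (simp only: chain_map_diff chain_map_funpow_Suc')
        also have "\<dots> = 0" by (rule telescope[OF wj])
        finally show ?thesis .
      qed
    qed
    \<comment> \<open>\<open>T\<close> preserves the augmentation, so a difference of a 0-chain and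
      its image has augmentation 0.\<close>
    have "cochain_eval 0 (\<lambda>_. 1) (equivariant_boundary p T k (w k)) = 0" if "k = 0"
      using that by (simp add: equivariant_boundary_def cochain_eval_diff cochain_eval_chain_map)
    then have "singular_chain (Suc k) Y (w (Suc k)) \<and>
      chain_boundary (Suc k) (w (Suc k)) = equivariant_boundary p T k (w k)"
      using fill[OF _ IH(1) _ cycle] Suc.prems by simp
    then show ?case
      using Suc by (auto simp: less_Suc_eq le_Suc_eq)
  qed
  then have "resolution_chains p T Y n w"
    unfolding resolution_chains_def by (auto simp: w_0)
  then show ?thesis by blast
qed

subsection \<open>Periodic points\<close>

text \<open>A gap of given size is unique and depends locally constantly on the sequence.\<close>
definition is_gap :: "nat \<Rightarrow> (nat \<Rightarrow> real) \<Rightarrow> nat set \<Rightarrow> bool"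
  where "is_gap p z S \<longleftrightarrow> S \<noteq> {} \<and> S \<subset> {..<p} \<and> (\<forall>a\<in>S. \<forall>b\<in>{..<p} - S. z a < z b)"

text \<open>Of two different sets of equal size neither contains the other, and elements of the two
  differences would each have to lie strictly below the other.\<close>

lemma is_gap_unique:
  assumes "is_gap p z S" "is_gap p z S'" "card S = card S'"
  shows "S = S'"
proof (rule ccontr)
  assume "S \<noteq> S'"
  have fin: "finite S" "finite S'"
    using assms finite_subset[of _ "{..<p}"] by (auto simp: is_gap_def)
  have "\<not> S \<subseteq> S'" "\<not> S' \<subseteq> S"
    using fin assms(3) \<open>S \<noteq> S'\<close> card_subset_eq[of S' S] card_subset_eq[of S S'] by auto
  then obtain a b where "a \<in> S" "a \<notin> S'" "b \<in> S'" "b \<notin> S"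
    by blast
  then have "z a < z b" "z b < z a"
    using assms by (auto simp: is_gap_def)
  then show False by simp
qed

text \<open>The positions of the minimum form a gap; they do not fill \<open>{..<p}\<close> because
  two neighbouring entries differ.\<close>

lemma is_gap_exists:
  assumes "Suc c < p" "z c \<noteq> z (Suc c)"
  shows "\<exists>S. is_gap p z S"
proof -
  define m where "m = Min (z ` {..<p})"
  have m: "m \<le> z a" if "a < p" for a
    unfolding m_def by (rule Min_le) (use that in auto)
  have "m \<in> z ` {..<p}"
    unfolding m_def by (intro Min_in) (use assms in auto)
  moreover have "{a \<in> {..<p}. z a = m} \<noteq> {..<p}"
  proof
    assume "{a \<in> {..<p}. z a = m} = {..<p}"
    then have "\<forall>a\<in>{..<p}. z a = m"
      by blast
    then have "z c = m" "z (Suc c) = m"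
      using assms(1) by simp_all
    then show False using assms(2) by simp
  qed
  moreover have "z a < z b" if "a \<in> {a \<in> {..<p}. z a = m}" "b \<in> {..<p} - {a \<in> {..<p}. z a = m}" for a b
    using that m[of b] by auto
  ultimately have "is_gap p z {a \<in> {..<p}. z a = m}"
    unfolding is_gap_def by (intro conjI) auto
  then show ?thesis by blast
qed

text \<open>A preimage under rotation, since passing from \<open>y\<close> to \<open>T y\<close>
  moves entry \<open>a + 1\<close> of the orbit sequence to place \<open>a\<close>.\<close>

definition cyclic_shift :: "nat \<Rightarrow> nat set \<Rightarrow> nat set"
  where "cyclic_shift p S = {a \<in> {..<p}. Suc a mod p \<in> S}"

lemma bij_betw_Suc_mod:
  assumes "S \<subseteq> {..<p}"
  shows "bij_betw (\<lambda>a. Suc a mod p) (cyclic_shift p S) S"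
proof -
  have inj: "inj_on (\<lambda>a. Suc a mod p) {..<p}"
    by (rule inj_onI) (auto simp: mod_Suc split: if_splits)
  have "b \<in> (\<lambda>a. Suc a mod p) ` cyclic_shift p S" if "b \<in> S" for b
  proof (cases b)
    case 0
    then show ?thesis
      using that assms by (intro image_eqI[of _ _ "p - 1"]) (auto simp: cyclic_shift_def)
  next
    case (Suc a)
    then show ?thesis
      using that assms by (intro image_eqI[of _ _ a]) (auto simp: cyclic_shift_def)
  qed
  then show ?thesis
    unfolding bij_betw_def by (auto simp: cyclic_shift_def intro: inj_on_subset[OF inj])
qed

lemma card_cyclic_shift: "S \<subseteq> {..<p} \<Longrightarrow> card (cyclic_shift p S) = card S"
  by (rule bij_betw_same_card[OF bij_betw_Suc_mod])

lemma sum_cyclic_shift: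
  assumes "S \<subseteq> {..<p}"
  shows "[int (\<Sum>S) = int (\<Sum>(cyclic_shift p S)) + int (card S)] (mod int p)"
proof -
  have "\<Sum>S = (\<Sum>a\<in>cyclic_shift p S. Suc a mod p)"
    by (rule sum.reindex_bij_betw[OF bij_betw_Suc_mod[OF assms], symmetric])
  also have "[\<dots> = (\<Sum>a\<in>cyclic_shift p S. Suc a)] (mod p)"
    by (simp add: cong_def mod_sum_eq)
  also have "(\<Sum>a\<in>cyclic_shift p S. Suc a) = \<Sum>(cyclic_shift p S) + card S"
    unfolding Suc_eq_plus1 sum.distrib using card_cyclic_shift[OF assms] by simp
  finally have "[int (\<Sum>S) = int (\<Sum>(cyclic_shift p S) + card S)] (mod int p)"
    by (simp only: cong_int_iff)
  then show ?thesis
    by (simp only: of_nat_add)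
qed

lemma is_gap_cyclic_shift:
  assumes "is_gap p z S" and "z p = z 0"
  shows "is_gap p (\<lambda>a. z (Suc a)) (cyclic_shift p S)"
proof -
  have S: "S \<subseteq> {..<p}" "S \<noteq> {}" "card S < card {..<p}"
    using assms(1) psubset_card_mono[of "{..<p}" S] by (auto simp: is_gap_def)
  \<comment> \<open>Periodicity enters at the wrap-around \<open>a = p - 1\<close>.\<close>
  have z: "z (Suc a) = z (Suc a mod p)" if "a < p" for a
    using that assms(2) by (cases "Suc a = p") auto
  have "cyclic_shift p S \<noteq> {}"
    using bij_betw_imp_surj_on[OF bij_betw_Suc_mod[OF S(1)]] S(2) by auto
  moreover have "cyclic_shift p S \<noteq> {..<p}"
  proof
    assume "cyclic_shift p S = {..<p}"
    with card_cyclic_shift[OF S(1)] have "card {..<p} = card S"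
      by (simp only:)
    with S(3) show False by simp
  qed
  moreover have "z (Suc a) < z (Suc b)" if "a \<in> cyclic_shift p S" "b \<in> {..<p} - cyclic_shift p S" for a b
  proof -
    have "Suc a mod p \<in> S" "Suc b mod p \<in> {..<p} - S" "a < p" "b < p"
      using that by (auto simp: cyclic_shift_def)
    then show ?thesis
      using assms(1) z[of a] z[of b] by (simp add: is_gap_def)
  qed
  moreover have "cyclic_shift p S \<subseteq> {..<p}"
    by (auto simp: cyclic_shift_def)
  ultimately show ?thesis
    unfolding is_gap_def psubset_eq by blast
qed

text \<open>An equivariant map from the subsets of \<open>\<int>/p\<close> of a size prime to \<open>p\<close> to \<open>\<int>/p\<close>.\<close>
definition cyclic_position :: "nat \<Rightarrow> nat set \<Rightarrow> int"
  where "cyclic_position p S = (SOME c. [c * int (card S) + int (\<Sum>S) = 0] (mod int p))"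

text \<open>The position is minus the mean of \<open>S\<close> modulo \<open>p\<close>, which exists
  because \<open>card S\<close> is invertible.\<close>

lemma cyclic_position:
  assumes "coprime (card S) p"
  shows "[cyclic_position p S * int (card S) + int (\<Sum>S) = 0] (mod int p)"
proof -
  obtain c where "[int (card S) * c = 1] (mod int p)"
    using cong_solve_coprime_int[of "int (card S)" "int p"] assms by auto
  then have "[(int (card S) * c) * (- int (\<Sum>S)) + int (\<Sum>S) = 1 * (- int (\<Sum>S)) + int (\<Sum>S)] (mod int p)"
    by (intro cong_add cong_scalar_right) simp_all
  then have "[(- c * int (\<Sum>S)) * int (card S) + int (\<Sum>S) = 0] (mod int p)"
    by (simp add: mult.commute mult.left_commute)
  then show ?thesis
    unfolding cyclic_position_def by (rule someI)
qed

text \<open>The shift lowers the sum of the elements by \<open>card S\<close> modulo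
  \<open>p\<close>; dividing by minus \<open>card S\<close> turns this into an increase by
  1.\<close>

lemma cyclic_position_shift:
  assumes "S \<subseteq> {..<p}" "coprime (card S) p"
  shows "[cyclic_position p (cyclic_shift p S) = cyclic_position p S + 1] (mod int p)"
proof -
  let ?r = "int (card S)"
  have 1: "[cyclic_position p (cyclic_shift p S) * ?r + int (\<Sum>(cyclic_shift p S)) = 0] (mod int p)"
    using cyclic_position[of "cyclic_shift p S" p] assms(2) card_cyclic_shift[OF assms(1)] by simp
  have "[cyclic_position p (cyclic_shift p S) * ?r = (cyclic_position p S + 1) * ?r] (mod int p)"
    using cong_diff[OF cong_diff[OF 1 cyclic_position[OF assms(2)]] sum_cyclic_shift[OF assms(1)]]
    using cong_add[OF cong_diff[OF 1 cyclic_position[OF assms(2)]] sum_cyclic_shift[OF assms(1)]]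
    by (simp add: cong_iff_dvd_diff algebra_simps)
  then show ?thesis
    using assms(2) by (simp add: cong_mult_rcancel)
qed

text \<open>If all these groups vanished, a resolution of length \<open>2 * (N * p)\<close> would
  exist in \<open>P_p(X)\<close>. The gap positions give a cover by \<open>N * p\<close> pieces with
  equivariant locally constant maps, which excludes one.\<close>

lemma periodic_points_pi_nonzero:
  fixes X :: "'a topology" and \<phi> :: "nat \<Rightarrow> 'a \<Rightarrow> real"
  assumes "continuous_map X X T" and "prime p"
    and \<phi>: "\<And>i. i < N \<Longrightarrow> continuous_map X euclideanreal (\<phi> i)"
    and separate: "\<And>x. x \<in> topspace X \<Longrightarrow> \<exists>i<N. \<phi> i x \<noteq> \<phi> i (T x)"
    and "topspace (periodic_points X T p) \<noteq> {}"
  shows "\<exists>k < 2 * (N * p). pi_nonzero k (periodic_points X T p)"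
proof (rule ccontr)
  assume no: "\<not> ?thesis"
  define Y where "Y = periodic_points X T p"
  have p: "p \<ge> 2"
    using \<open>prime p\<close> by (rule prime_ge_2_nat)
  have Y: "topspace Y = {x \<in> topspace X. (T ^^ p) x = x}"
    by (auto simp: Y_def periodic_points_def)
  have T_pow: "continuous_map X X (T ^^ a)" for a
    by (induction a) (simp_all add: continuous_map_compose[OF _ assms(1), unfolded o_def] o_def)
  have T_in: "T x \<in> topspace Y" if "x \<in> topspace Y" for x
    using that continuous_map_image_subset_topspace[OF assms(1)]
    by (auto simp: Y funpow_swap1[symmetric])
  have "continuous_map Y Y T"
    using assms(1) T_in unfolding Y_def periodic_points_def
    by (auto simp: continuous_map_in_subtopology continuous_map_from_subtopology)
  moreover obtain b where "b \<in> topspace Y"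
    using assms(5) unfolding Y_def by blast
  moreover have "\<not> pi_nonzero i Y" if "i < 2 * (N * p)" for i
    using no that unfolding Y_def by blast
  ultimately have "\<exists>w. resolution_chains p T Y (2 * (N * p)) w"
    by (intro resolution_chains_exist) (simp_all add: Y)
  \<comment> \<open>An index \<open>j < N * p\<close> encodes a pair: the function
    \<open>\<phi> (j div p)\<close> and the gap size \<open>j mod p\<close>.\<close>
  define z where "z j y a = \<phi> (j div p) ((T ^^ a) y)" for j y a
  define gap where "gap j y S \<longleftrightarrow> is_gap p (z j y) S \<and> card S = j mod p" for j y S
  have gap_coprime: "S \<subseteq> {..<p}" "coprime (card S) p" if "gap j y S" for j y S
  proof -
    have S: "S \<subset> {..<p}" "S \<noteq> {}"
      using that unfolding gap_def is_gap_def by simp_all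
    then show "S \<subseteq> {..<p}" by blast
    then have "finite S" by (rule finite_subset) simp
    then have "card S > 0" "card S < p"
      using S psubset_card_mono[of "{..<p}" S] by (simp_all add: card_gt_0_iff)
    then have "\<not> p dvd card S"
      by (simp add: nat_dvd_not_less)
    then have "coprime p (card S)"
      by (rule prime_imp_coprime[OF \<open>prime p\<close>])
    then show "coprime (card S) p"
      by (simp add: coprime_commute)
  qed
  have gap_unique: "S = S'" if "gap j y S" "gap j y S'" for j y S S'
    using that is_gap_unique by (metis gap_def)
  have gap_shift: "gap j (T y) (cyclic_shift p S)" if "gap j y S" "y \<in> topspace Y" for j y S
  proof -
    have "z j (T y) = (\<lambda>a. z j y (Suc a))"
      by (simp add: z_def fun_eq_iff funpow_swap1)
    moreover have "z j y p = z j y 0"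
      using that(2) by (simp add: z_def Y)
    ultimately show ?thesis
      using that(1) is_gap_cyclic_shift[of p "z j y" S] card_cyclic_shift[OF gap_coprime(1)[OF that(1)]]
      by (simp add: gap_def)
  qed
  have gap_pow: "\<exists>S. gap j ((T ^^ a) y) S" if "gap j y S" "y \<in> topspace Y" for j y S a
  proof -
    have "(T ^^ a) y \<in> topspace Y \<and> (\<exists>S. gap j ((T ^^ a) y) S)"
    proof (induction a)
      case (Suc a)
      then show ?case
        using gap_shift T_in by (metis funpow.simps(2) o_apply)
    qed (use that in auto)
    then show ?thesis by blast
  qed
  \<comment> \<open>Having a gap passes forward along the orbit; the converse follows by going on
    through the remaining \<open>p - 1\<close> steps back to \<open>y\<close>.\<close>
  have gap_T: "(\<exists>S. gap j (T y) S) \<longleftrightarrow> (\<exists>S. gap j y S)" if y: "y \<in> topspace Y" for j y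
  proof
    assume "\<exists>S. gap j (T y) S"
    then have "\<exists>S. gap j ((T ^^ (p - 1)) (T y)) S"
      using gap_pow T_in[OF y] by blast
    moreover have "(T ^^ (p - 1)) (T y) = (T ^^ p) y"
      using p by (cases p) (simp_all add: funpow_swap1)
    ultimately show "\<exists>S. gap j y S"
      using y by (simp add: Y)
  qed (use gap_shift y in blast)
  have gap_exists: "\<exists>j<N * p. \<exists>S. gap j y S" if y: "y \<in> topspace Y" for y
  proof -
    obtain i where i: "i < N" "\<phi> i y \<noteq> \<phi> i (T y)"
      using separate[of y] y by (auto simp: Y)
    obtain S where S: "is_gap p (\<lambda>a. \<phi> i ((T ^^ a) y)) S"
      using is_gap_exists[of 0 p "\<lambda>a. \<phi> i ((T ^^ a) y)"] i p by auto
    have "card S < p"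
      using S psubset_card_mono[of "{..<p}" S] by (auto simp: is_gap_def)
    then have "gap (i * p + card S) y S"
      using S by (simp add: gap_def z_def[abs_def])
    moreover have "i * p + card S < N * p"
    proof -
      have "i * p + card S < Suc i * p"
        using \<open>card S < p\<close> by simp
      also have "\<dots> \<le> N * p"
        using i(1) by (intro mult_le_mono1) simp
      finally show ?thesis .
    qed
    ultimately show ?thesis by blast
  qed
  define pos where "pos j y = cyclic_position p (THE S. gap j y S)" for j y
  have pos: "pos j y = cyclic_position p S" if "gap j y S" for j y S
  proof -
    have "(THE S. gap j y S) = S"
      by (rule the_equality) (rule that, rule gap_unique[OF _ that])
    then show ?thesis
      by (simp add: pos_def)
  qed
  have pos_T: "[pos j (T y) = pos j y + 1] (mod int p)" if "gap j y S" "y \<in> topspace Y" for j y S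
    using cyclic_position_shift gap_coprime[OF that(1)] pos[OF that(1)] pos[OF gap_shift[OF that]] by simp
  \<comment> \<open>\<open>l j\<close> has to be equivariant on all of \<open>Y\<close>. Where index
    \<open>j\<close> has no gap, the least index that has one replaces it, a choice constant along
    orbits.\<close>
  define l where "l j y = pos (if \<exists>S. gap j y S then j else LEAST j. \<exists>S. gap j y S) y" for j y
  have l: "[l j (T y) = l j y + 1] (mod int p)" if y: "y \<in> topspace Y" for j y
  proof (cases "\<exists>S. gap j y S")
    case True
    then show ?thesis
      using pos_T y gap_T[OF y] by (auto simp: l_def)
  next
    case False
    have "\<exists>j S. gap j y S"
      using gap_exists[OF y] by blast
    then have "\<exists>S. gap (LEAST j. \<exists>S. gap j y S) y S"
      by (rule LeastI_ex)
    then show ?thesis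
      using False pos_T y gap_T[OF y] by (auto simp: l_def)
  qed
  have "\<exists>U j. openin Y U \<and> y \<in> U \<and> j < N * p \<and> (\<forall>x\<in>U. l j x = l j y)" if y: "y \<in> topspace Y" for y
  proof -
    obtain j S where j: "j < N * p" and S: "gap j y S"
      using gap_exists[OF y] by blast
    define V where "V = (\<lambda>(a, b). {x \<in> topspace Y. z j x b - z j x a \<in> {0<..}})"
    \<comment> \<open>The finitely many strict inequalities that make \<open>S\<close> a gap at
      \<open>y\<close> cut out an open set on which \<open>S\<close> remains the gap for
      \<open>j\<close>.\<close>
    define U where "U = (\<Inter>ab \<in> S \<times> ({..<p} - S). V ab)"
    have "j div p < N"
      using j by (simp add: less_mult_imp_div_less)
    then have z_cont: "continuous_map Y euclideanreal (\<lambda>x. z j x a)" for a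
      using continuous_map_compose[OF T_pow \<phi>] unfolding z_def Y_def periodic_points_def
      by (simp add: continuous_map_from_subtopology o_def)
    have "openin Y (V ab)" for ab
      unfolding V_def case_prod_beta
      by (intro openin_continuous_map_preimage[of _ euclideanreal] continuous_map_diff z_cont) auto
    moreover have "finite (S \<times> ({..<p} - S))" "S \<times> ({..<p} - S) \<noteq> {}"
      using S finite_subset[of S "{..<p}"] by (auto simp: gap_def is_gap_def)
    ultimately have "openin Y U"
      unfolding U_def by (intro openin_INT2)
    moreover have "y \<in> U"
      using S y by (auto simp: U_def V_def gap_def is_gap_def)
    moreover have "gap j x S" if "x \<in> U" for x
      using that S by (auto simp: U_def V_def gap_def is_gap_def)
    moreover have "l j x = cyclic_position p S" if "gap j x S" for x
      using that pos[OF that] by (auto simp: l_def)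
    ultimately show ?thesis
      using j S by (intro exI[of _ U] exI[of _ j]) simp
  qed
  from resolution_chains_length[OF p T_in l this] \<open>\<exists>w. _\<close> show False
    by blast
qed

text \<open>The distance to \<open>a\<close> separates \<open>a\<close> from \<open>T a\<close>, and
  by continuity also \<open>x\<close> from \<open>T x\<close> for all \<open>x\<close> near
  \<open>a\<close>. Finitely many of these neighbourhoods cover the compact space.\<close>

lemma separating_functions:
  assumes "compact_space X" "metrizable_space X" and T: "continuous_map X X T"
    and free: "\<And>x. x \<in> topspace X \<Longrightarrow> T x \<noteq> x"
  shows "\<exists>N \<phi>. (\<forall>i<N::nat. continuous_map X euclideanreal (\<phi> i)) \<and>
           (\<forall>x\<in>topspace X. \<exists>i<N. \<phi> i x \<noteq> \<phi> i (T x))"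
proof -
  obtain M d where "Metric_space M d" and X: "X = Metric_space.mtopology M d"
    using assms(2) by (auto simp: metrizable_space_def)
  interpret Metric_space M d by fact
  have cont: "continuous_map X euclideanreal (d a)" if "a \<in> M" for a
    using continuous_map_mdist[of X Self "\<lambda>_. a" "\<lambda>x. x"] that by (simp add: X mtopology_of_def)
  define V where "V a = {x \<in> topspace X. d a x - d a (T x) \<in> - {0}}" for a
  have V_open: "openin X (V a)" if "a \<in> M" for a
    unfolding V_def using continuous_map_compose[OF T cont[OF that]]
    by (intro openin_continuous_map_preimage[of _ euclideanreal] continuous_map_diff cont that) (auto simp: o_def)
  have T_in: "T x \<in> M" if "x \<in> M" for x
    using continuous_map_image_subset_topspace[OF T] that by (auto simp: X)
  have "a \<in> V a" if "a \<in> M" for a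
    using that free[of a] T_in[OF that] by (auto simp: V_def X)
  then have "topspace X \<subseteq> \<Union>(V ` M)"
    by (auto simp: X)
  then obtain \<F> where \<F>: "finite \<F>" "\<F> \<subseteq> V ` M" "topspace X \<subseteq> \<Union>\<F>"
    using assms(1) V_open unfolding compact_space_alt by (metis (no_types, lifting) imageE)
  obtain F where F: "finite F" "F \<subseteq> M" "\<F> = V ` F"
    using finite_subset_image[OF \<F>(1,2)] by blast
  obtain f and N :: nat where f: "F = f ` {i. i < N}"
    using finite_imp_nat_seg_image_inj_on[OF F(1)] by blast
  have "continuous_map X euclideanreal (d (f i))" if "i < N" for i
    using cont F(2) f that by auto
  moreover have "\<exists>i<N. d (f i) x \<noteq> d (f i) (T x)" if "x \<in> topspace X" for x
    using \<F>(3) that by (auto simp: F(3) f V_def)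
  ultimately show ?thesis
    by (intro exI[of _ N] exI[of _ "\<lambda>i. d (f i)"]) auto
qed

text \<open>The index \<open>n\<close> in \<open>conn\<close> stands for degree
  \<open>n + 1\<close>, so for nonempty \<open>Y\<close> the connectivity is one less than the first
  nonzero degree.\<close>

lemma conn_le:
  assumes "pi_nonzero k Y"
  shows "conn Y \<le> ereal (real k)"
proof (cases "topspace Y = {}")
  case False
  define m where "m = (LEAST m. pi_nonzero m Y)"
  have m: "pi_nonzero m Y" "m \<le> k"
    using assms LeastI[of "\<lambda>m. pi_nonzero m Y"] Least_le[of "\<lambda>m. pi_nonzero m Y"]
    by (auto simp: m_def)
  let ?P = "\<lambda>n::int. n \<ge> - 1 \<and> pi_nonzero (nat (n + 1)) Y"
  have P: "?P (int m - 1)"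
    using m by simp
  moreover have "int m - 1 \<le> n" if "?P n" for n
  proof -
    have "m \<le> nat (n + 1)"
      unfolding m_def using that by (intro Least_le) simp
    then show ?thesis
      using that by linarith
  qed
  ultimately have "(LEAST n. ?P n) = int m - 1"
    by (rule Least_equality)
  then have "conn Y = ereal (of_int (int m - 1))"
    using False exI[of ?P, OF P] by (simp add: conn_def)
  then show ?thesis
    using m(2) by simp
qed (simp add: conn_def)

theorem corollary1p3:
  fixes X :: "'a topology" and T :: "'a \<Rightarrow> 'a"
  assumes "dynamical_system X T" and "fixed_point_free X T"
  shows "\<exists>C::real. C > 0 \<and>
           (\<forall>p::nat. prime p \<longrightarrow> conn (periodic_points X T p) < ereal (C * real p))"
proof -
  have T: "continuous_map X X T"
    using assms(1) by (simp add: dynamical_system_def homeomorphic_imp_continuous_map)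
  have "T x \<noteq> x" if "x \<in> topspace X" for x
    using assms(2) that by (auto simp: fixed_point_free_def periodic_points_def)
  then have "\<exists>N \<phi>. (\<forall>i<N::nat. continuous_map X euclideanreal (\<phi> i)) \<and>
      (\<forall>x\<in>topspace X. \<exists>i<N. \<phi> i x \<noteq> \<phi> i (T x))"
    using assms(1) T by (intro separating_functions) (auto simp: dynamical_system_def)
  then obtain N and \<phi> :: "nat \<Rightarrow> 'a \<Rightarrow> real"
    where "\<forall>i<N. continuous_map X euclideanreal (\<phi> i)"
      and "\<forall>x\<in>topspace X. \<exists>i<N. \<phi> i x \<noteq> \<phi> i (T x)"
    by blast
  then have \<phi>: "\<And>i. i < N \<Longrightarrow> continuous_map X euclideanreal (\<phi> i)"
    and separate: "\<And>x. x \<in> topspace X \<Longrightarrow> \<exists>i<N. \<phi> i x \<noteq> \<phi> i (T x)"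
    by simp_all
  \<comment> \<open>The degree found is below \<open>2 * N * p\<close>; the additional 1 keeps the
    constant positive when \<open>N = 0\<close>. Without periodic points the convention gives
    -2.\<close>
  have "conn (periodic_points X T p) < ereal ((2 * real N + 1) * real p)" if p: "prime p" for p
  proof (cases "topspace (periodic_points X T p) = {}")
    case True
    have "- 2 < (2 * real N + 1) * real p"
      by (rule less_le_trans[of _ 0]) simp_all
    then have "ereal (- 2) < ereal ((2 * real N + 1) * real p)"
      by (simp only: less_ereal.simps)
    with True show ?thesis
      by (simp add: conn_def)
  next
    case False
    then obtain k where k: "k < 2 * (N * p)" "pi_nonzero k (periodic_points X T p)"
      using periodic_points_pi_nonzero[OF T p \<phi> separate] by blast
    have "real k < real (2 * (N * p))"
      using k(1) by (simp only: of_nat_less_iff)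
    then have "real k < (2 * real N + 1) * real p"
      by (simp add: algebra_simps)
    then show ?thesis
      using conn_le[OF k(2)] by (metis ereal_less_eq(3) le_less_trans less_ereal.simps(1))
  qed
  then show ?thesis
    by (intro exI[of _ "2 * real N + 1"]) auto
qed

end
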